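(* There exist a sofic group $\Gamma$, two sofic approximations $\Sigma_1,\Sigma_2$ to $\Gamma$, and a continuous action $\Gamma\curvearrowright X$ on a compact metric space such that the topological sofic entropies satisfy $$h_{\Sigma_1}(\Gamma\curvearrowright X)\neq h_{\Sigma_2}(\Gamma\curvearrowright X).$$ Moreover, there exists an invariant Borel probability measure $\mu$ on $X$ such that $$h_{\Sigma_1,\mu}(\Gamma\curvearrowright X)\neq h_{\Sigma_2,\mu}(\Gamma\curvearrowright X).$$
   Context: Sofic approximation to a countable group $\Gamma$: a sequence $\Sigma=\{\sigma_i:\Gamma\to\mathrm{Sym}(V_i)\}$ of maps, $V_i$ finite sets, $|V_i|\to\infty$, such that for all $g,h\in\Gamma$, $|V_i|^{-1}\#\{p\in V_i:\sigma_i(g)\sigma_i(h)p=\sigma_i(gh)p\}\to1$, and for all $g\ne e$, $|V_i|^{-1}\#\{p\in V_i:\sigma_i(g)p=p\}\to0$. A countable group is sofic if it admits a sofic approximation. Topological sofic entropy: let $T=(T^g)_{g\in\Gamma}$ be an action by homeomorphisms on a compact metrizable space $X$ and $\rho$ a continuous generating pseudometric on $X$ (generating: for $x\neq y$ there is $g$ with $\rho(T^gx,T^gy)>0$). For a finite set $V$ and $x,y\in X^V$ let $\rho_\infty(x,y)=\max_v\rho(x_v,y_v)$ and $\rho_2(x,y)=(|V|^{-1}\sum_v\rho(x_v,y_v)^2)^{1/2}$. For $F\subset\Gamma$ finite, $\delta>0$, $\sigma:\Gamma\to\mathrm{Sym}(V)$, let $\mathrm{Map}(T,\rho,F,\delta,\sigma)$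 be the set of $x\in X^V$ with $\rho_2(T^fx,x\circ\sigma(f))<\delta$ for all $f\in F$, where $(T^fx)_v=T^fx_v$, $(x\circ\sigma(f))_v=x_{\sigma(f)v}$. Let $N_\epsilon(S,\rho_\infty)$ be the maximum cardinality of a subset of $S$ whose distinct points are at $\rho_\infty$-distance $\ge\epsilon$. Then $h_\Sigma(\Gamma\curvearrowright X)=\sup_{\epsilon>0}\inf_F\inf_{\delta>0}\limsup_i|V_i|^{-1}\log N_\epsilon(\mathrm{Map}(T,\rho,F,\delta,\sigma_i),\rho_\infty)$, with $\log 0=-\infty$; this is independent of $\rho$. Measure sofic entropy: if $\mu$ is an invariant Borel probability measure, $h_{\Sigma,\mu}(\Gamma\curvearrowright X)$ is defined by the same formula with $\mathrm{Map}(T,\rho,F,\delta,\sigma_i)$ replaced by its subset of those $x$ with $|V_i|^{-1}\sum_{v\in V_i}\delta_{x_v}\in O$, and with an additional infimum, taken right after $\sup_\epsilon$, over weak* open neighborhoods $O$ of $\mu$ in the space of Borel probability measures on $X$. *)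

theory Defs
  imports
    "HOL-Probability.Probability"
    "HOL-Algebra.Group_Action"
    "HOL-Combinatorics.Permutations"
begin

section \<open>Sofic approximations and sofic groups\<close>

definition sofic_approximation ::
  "('g, 'b) monoid_scheme \<Rightarrow> (nat \<Rightarrow> 'v set) \<Rightarrow> (nat \<Rightarrow> 'g \<Rightarrow> 'v \<Rightarrow> 'v) \<Rightarrow> bool" where
  "sofic_approximation G V \<sigma> \<longleftrightarrow>
     (\<forall>i. finite (V i)) \<and>
     (\<forall>i. \<forall>g\<in>carrier G. \<sigma> i g permutes V i) \<and>
     filterlim (\<lambda>i. card (V i)) at_top sequentially \<and>
     (\<forall>g\<in>carrier G. \<forall>h\<in>carrier G.
        (\<lambda>i. real (card {p \<in> V i. \<sigma> i g (\<sigma> i h p) = \<sigma> i (g \<otimes>\<^bsub>G\<^esub> h) p}) / real (card (V i)))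
          \<longlonglongrightarrow> 1) \<and>
     (\<forall>g\<in>carrier G. g \<noteq> \<one>\<^bsub>G\<^esub> \<longrightarrow>
        (\<lambda>i. real (card {p \<in> V i. \<sigma> i g p = p}) / real (card (V i))) \<longlonglongrightarrow> 0)"

text \<open>Every finite set is in bijection with a set of natural numbers, so taking the finite sets
  \<open>V i\<close> inside \<^typ>\<open>nat\<close> is no restriction.\<close>

definition sofic_group :: "('g, 'b) monoid_scheme \<Rightarrow> bool" where
  "sofic_group G \<longleftrightarrow> group G \<and> countable (carrier G) \<and>
     (\<exists>(V :: nat \<Rightarrow> nat set) \<sigma>. sofic_approximation G V \<sigma>)"

section \<open>Actions by homeomorphisms and generating pseudometrics\<close>

definition continuous_group_action ::
  "('g, 'b) monoid_scheme \<Rightarrow> 'x topology \<Rightarrow> ('g \<Rightarrow> 'x \<Rightarrow> 'x) \<Rightarrow> bool" where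
  "continuous_group_action G X T \<longleftrightarrow>
     group_action G (topspace X) T \<and> (\<forall>g\<in>carrier G. homeomorphic_map X X (T g))"

definition continuous_pseudometric :: "'x topology \<Rightarrow> ('x \<Rightarrow> 'x \<Rightarrow> real) \<Rightarrow> bool" where
  "continuous_pseudometric X \<rho> \<longleftrightarrow>
     (\<forall>x\<in>topspace X. \<forall>y\<in>topspace X. 0 \<le> \<rho> x y) \<and>
     (\<forall>x\<in>topspace X. \<rho> x x = 0) \<and>
     (\<forall>x\<in>topspace X. \<forall>y\<in>topspace X. \<rho> x y = \<rho> y x) \<and>
     (\<forall>x\<in>topspace X. \<forall>y\<in>topspace X. \<forall>z\<in>topspace X. \<rho> x z \<le> \<rho> x y + \<rho> y z) \<and>
     continuous_map (prod_topology X X) euclideanreal (\<lambda>(x, y). \<rho> x y)"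

definition generating_pseudometric ::
  "('g, 'b) monoid_scheme \<Rightarrow> 'x topology \<Rightarrow> ('g \<Rightarrow> 'x \<Rightarrow> 'x) \<Rightarrow> ('x \<Rightarrow> 'x \<Rightarrow> real) \<Rightarrow> bool" where
  "generating_pseudometric G X T \<rho> \<longleftrightarrow>
     continuous_pseudometric X \<rho> \<and>
     (\<forall>x\<in>topspace X. \<forall>y\<in>topspace X. x \<noteq> y \<longrightarrow> (\<exists>g\<in>carrier G. \<rho> (T g x) (T g y) > 0))"

text \<open>On a compact metrizable space every compatible metric is such a pseudometric. The entropies
  below carry \<open>\<rho>\<close> as a parameter; their values do not depend on which generating pseudometric is
  used.\<close>

section \<open>Topological sofic entropy\<close>

definition rho_inf :: "('x \<Rightarrow> 'x \<Rightarrow> real) \<Rightarrow> 'v set \<Rightarrow> ('v \<Rightarrow> 'x) \<Rightarrow> ('v \<Rightarrow> 'x) \<Rightarrow> real" where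
  "rho_inf \<rho> V x y = Max ((\<lambda>v. \<rho> (x v) (y v)) ` V)"

definition rho_two :: "('x \<Rightarrow> 'x \<Rightarrow> real) \<Rightarrow> 'v set \<Rightarrow> ('v \<Rightarrow> 'x) \<Rightarrow> ('v \<Rightarrow> 'x) \<Rightarrow> real" where
  "rho_two \<rho> V x y = sqrt ((\<Sum>v\<in>V. (\<rho> (x v) (y v))\<^sup>2) / real (card V))"

text \<open>The power $X^V$ consists of extensional functions, so that it has one element for each
  $V$-indexed family of points and cardinalities of its subsets are the intended ones.\<close>

definition Map_set ::
  "'x topology \<Rightarrow> ('g \<Rightarrow> 'x \<Rightarrow> 'x) \<Rightarrow> ('x \<Rightarrow> 'x \<Rightarrow> real) \<Rightarrow> 'g set \<Rightarrow> real \<Rightarrow>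
   'v set \<Rightarrow> ('g \<Rightarrow> 'v \<Rightarrow> 'v) \<Rightarrow> ('v \<Rightarrow> 'x) set" where
  "Map_set X T \<rho> F \<delta> V s =
     {x \<in> V \<rightarrow>\<^sub>E topspace X. \<forall>f\<in>F. rho_two \<rho> V (\<lambda>v. T f (x v)) (\<lambda>v. x (s f v)) < \<delta>}"

text \<open>When \<open>X\<close> is compact, \<open>V\<close> is finite, \<open>\<rho>\<close> is a continuous pseudometric and \<open>\<epsilon> > 0\<close>, the
  cardinalities of separated subsets of $X^V$ are bounded, so the maximum below exists; it is
  \<open>0\<close> exactly for \<open>S = {}\<close>.\<close>

definition sep_number ::
  "('x \<Rightarrow> 'x \<Rightarrow> real) \<Rightarrow> 'v set \<Rightarrow> real \<Rightarrow> ('v \<Rightarrow> 'x) set \<Rightarrow> nat" where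
  "sep_number \<rho> V \<epsilon> S =
     Max {card A |A. A \<subseteq> S \<and> finite A \<and> (\<forall>x\<in>A. \<forall>y\<in>A. x \<noteq> y \<longrightarrow> rho_inf \<rho> V x y \<ge> \<epsilon>)}"

definition log_nat :: "nat \<Rightarrow> ereal" where
  "log_nat n = (if n = 0 then - \<infinity> else ereal (ln (real n)))"

definition top_sofic_entropy ::
  "('g, 'b) monoid_scheme \<Rightarrow> 'x topology \<Rightarrow> ('g \<Rightarrow> 'x \<Rightarrow> 'x) \<Rightarrow> ('x \<Rightarrow> 'x \<Rightarrow> real) \<Rightarrow>
   (nat \<Rightarrow> 'v set) \<Rightarrow> (nat \<Rightarrow> 'g \<Rightarrow> 'v \<Rightarrow> 'v) \<Rightarrow> ereal" where
  "top_sofic_entropy G X T \<rho> V \<sigma> =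
     (SUP \<epsilon>\<in>{0<..}. INF F\<in>{F. finite F \<and> F \<subseteq> carrier G}. INF \<delta>\<in>{0<..}.
        limsup (\<lambda>i. log_nat (sep_number \<rho> (V i) \<epsilon> (Map_set X T \<rho> F \<delta> (V i) (\<sigma> i)))
                      / ereal (real (card (V i)))))"

section \<open>Measure sofic entropy\<close>

definition borel_of_top :: "'x topology \<Rightarrow> 'x measure" where
  "borel_of_top X = sigma (topspace X) {U. openin X U}"

definition borel_prob_measures :: "'x topology \<Rightarrow> 'x measure set" where
  "borel_prob_measures X = {\<nu>. prob_space \<nu> \<and> sets \<nu> = sets (borel_of_top X)}"

definition invariant_measure ::
  "('g, 'b) monoid_scheme \<Rightarrow> 'x topology \<Rightarrow> ('g \<Rightarrow> 'x \<Rightarrow> 'x) \<Rightarrow> 'x measure \<Rightarrow> bool" where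
  "invariant_measure G X T \<mu> \<longleftrightarrow> (\<forall>g\<in>carrier G. distr \<mu> (borel_of_top X) (T g) = \<mu>)"

text \<open>The coarsest topology on the Borel probability measures for which integration of every
  continuous real function is continuous; on a compact space all such functions are bounded.\<close>

definition weak_star_topology :: "'x topology \<Rightarrow> 'x measure topology" where
  "weak_star_topology X = topology_generated_by
     {{\<nu> \<in> borel_prob_measures X. (\<integral>x. f x \<partial>\<nu>) \<in> U} |f U.
        continuous_map X euclideanreal f \<and> open U}"

text \<open>The average of the point masses at the \<open>x v\<close>, as the push-forward under \<open>x\<close> of the
  uniform probability measure on \<open>V\<close>.\<close>

definition empirical_measure :: "'x topology \<Rightarrow> 'v set \<Rightarrow> ('v \<Rightarrow> 'x) \<Rightarrow> 'x measure" where
  "empirical_measure X V x = distr (uniform_count_measure V) (borel_of_top X) x"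

definition measure_sofic_entropy ::
  "('g, 'b) monoid_scheme \<Rightarrow> 'x topology \<Rightarrow> ('g \<Rightarrow> 'x \<Rightarrow> 'x) \<Rightarrow> ('x \<Rightarrow> 'x \<Rightarrow> real) \<Rightarrow>
   'x measure \<Rightarrow> (nat \<Rightarrow> 'v set) \<Rightarrow> (nat \<Rightarrow> 'g \<Rightarrow> 'v \<Rightarrow> 'v) \<Rightarrow> ereal" where
  "measure_sofic_entropy G X T \<rho> \<mu> V \<sigma> =
     (SUP \<epsilon>\<in>{0<..}. INF O'\<in>{O'. openin (weak_star_topology X) O' \<and> \<mu> \<in> O'}.
      INF F\<in>{F. finite F \<and> F \<subseteq> carrier G}. INF \<delta>\<in>{0<..}.
        limsup (\<lambda>i. log_nat (sep_number \<rho> (V i) \<epsilon>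
                       {x \<in> Map_set X T \<rho> F \<delta> (V i) (\<sigma> i). empirical_measure X (V i) x \<in> O'})
                      / ereal (real (card (V i)))))"

end

theory Submission
  imports Defs
begin

text \<open>
  The two entropies differ in the crudest way: one is \<open>- \<infinity>\<close> because there are no approximate models
  at all, the other is nonnegative because there is an exact model.

  Let the group be \<open>GL\<^sub>2(\<int>) \<ltimes> \<int>\<^sup>2\<close>, acting on a two-point space through the determinant: elements of
  determinant \<open>-1\<close> exchange the two points. An approximate model on a finite set is then a function
  with values \<open>1\<close> and \<open>-1\<close> that is almost preserved by elements of determinant \<open>1\<close> and almost negated
  by those of determinant \<open>-1\<close>. The group acts by affine maps on \<open>(\<int>/p)\<^sup>2\<close>, and for primes \<open>p\<close>
  tending to infinity this is a sofic approximation, since the fixed points of a nontrivial element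
  satisfy a nontrivial linear equation modulo \<open>p\<close>. The second approximation is the double cover
  \<open>(\<int>/p)\<^sup>2 \<times> {1, -1}\<close> with the determinant acting on the new coordinate; that coordinate is an exact
  model, and it takes both values equally often, so its empirical measure is the uniform measure
  on the two points.

  On \<open>(\<int>/p)\<^sup>2\<close> itself no approximate model exists, by the expansion of the affine action in the manner
  of Margulis and Gabber--Galil (lemma \<open>almost_invariant_imp_large_sum\<close>). Suppose that a function is
  almost invariant under the two unit translations and the elementary shears. The squared absolute
  value of its Fourier transform is a mass distribution on the frequencies. Almost invariance
  under translations puts most of the mass on small frequencies, where integer arithmetic sees no
  wrap-around modulo \<open>p\<close>, and almost invariance under shears makes the mass almost shear-invariant.
  But the cone of vectors with coordinates of equal sign is the disjoint union of its images under
  the two positive shears, so its mass is almost twice itself, hence almost zero; a rotated cone is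
  treated with the inverse shears. Thus almost all mass sits at the frequency zero: the sum of a
  sign function of this kind is large in absolute value. A reflection has determinant \<open>-1\<close>, so it
  almost negates the sum while permuting its terms, a contradiction
  (lemma \<open>no_almost_equivariant_sign\<close>).
\<close>

section \<open>Fourier analysis on a finite torus\<close>

lemma sum_periodic_shift:
  fixes h :: "int \<Rightarrow> 'a::comm_monoid_add"
  assumes "0 < p" and "\<And>x. h (x mod p) = h x"
  shows "(\<Sum>x\<in>{0..<p}. h (x + c)) = (\<Sum>x\<in>{0..<p}. h x)"
proof (rule sum.reindex_bij_witness[where i = "\<lambda>x. (x - c) mod p" and j = "\<lambda>x. (x + c) mod p"])
  fix x assume x: "x \<in> {0..<p}"
  show "((x + c) mod p - c) mod p = x"
    using x by (simp add: mod_diff_left_eq)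
  show "((x - c) mod p + c) mod p = x"
    using x by (simp add: mod_add_left_eq)
  show "h ((x + c) mod p) = h (x + c)" by (rule assms(2))
qed (use assms(1) in auto)

text \<open>Frequencies are taken in \<open>{-k..k}\<close> because smallness of a frequency refers to the representative
  of least absolute value; for odd moduli these representatives form a symmetric interval.\<close>
lemma sum_periodic_centred:
  fixes h :: "int \<Rightarrow> 'a::comm_monoid_add"
  assumes "0 \<le> k" and "p = 2 * k + 1" and "\<And>x. h (x mod p) = h x"
  shows "(\<Sum>x\<in>{-k..k}. h x) = (\<Sum>x\<in>{0..<p}. h x)"
proof -
  have "(\<Sum>x\<in>{-k..k}. h x) = (\<Sum>x\<in>{0..<p}. h (x + (-k)))"
    by (rule sum.reindex_bij_witness[where i = "\<lambda>x. x - k" and j = "\<lambda>x. x + k"])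
       (use assms in auto)
  also have "\<dots> = (\<Sum>x\<in>{0..<p}. h x)"
    by (rule sum_periodic_shift) (use assms in auto)
  finally show ?thesis .
qed

text \<open>The additive character \<open>t \<mapsto> exp(2 \<pi> i t / p)\<close> of the integers modulo \<open>p\<close>.\<close>
definition add_char :: "int \<Rightarrow> int \<Rightarrow> complex" where
  "add_char p t = cis (2 * pi * real_of_int t / real_of_int p)"

lemma add_char_0 [simp]: "add_char p 0 = 1"
  by (simp add: add_char_def)

lemma add_char_add: "add_char p (s + t) = add_char p s * add_char p t"
  by (simp add: add_char_def cis_mult ring_distribs add_divide_distrib)

lemma cnj_add_char: "cnj (add_char p t) = add_char p (- t)"
  by (simp add: add_char_def cis_cnj)

lemma add_char_multiple:
  assumes "0 < p" shows "add_char p (p * t) = 1"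
proof -
  have "2 * pi * real_of_int (p * t) / real_of_int p = 2 * pi * real_of_int t"
    using assms by simp
  then show ?thesis by (simp only: add_char_def cis_multiple_2pi Ints_of_int)
qed

lemma add_char_cong:
  assumes "0 < p" and "p dvd s - t"
  shows "add_char p s = add_char p t"
proof -
  obtain n where "s - t = p * n" using assms(2) by (rule dvdE)
  then have "s = t + p * n" by simp
  then show ?thesis by (simp add: add_char_add add_char_multiple[OF assms(1)])
qed

lemma add_char_eq_1_imp:
  assumes "0 < p" and "add_char p t = 1" shows "p dvd t"
proof -
  have "cos (2 * pi * real_of_int t / real_of_int p) = 1"
    using assms(2) by (simp add: add_char_def complex_eq_iff)
  then obtain n :: int where "2 * pi * real_of_int t / real_of_int p = of_int n * 2 * pi"
    by (auto simp: cos_one_2pi_int)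
  then have "real_of_int t = of_int (n * p)" using assms(1) by (simp add: field_simps)
  then have "t = n * p" by linarith
  then show ?thesis by simp
qed

text \<open>A shift of the summation index multiplies the sum by \<open>add_char p t\<close>, which forces the sum to
  vanish unless that factor is \<open>1\<close>.\<close>
lemma sum_add_char:
  assumes "0 < p"
  shows "(\<Sum>\<xi>\<in>{0..<p}. add_char p (\<xi> * t)) = (if p dvd t then of_int p else 0)"
proof (cases "p dvd t")
  case True
  then have "add_char p (\<xi> * t) = 1" for \<xi>
    using add_char_multiple[OF assms, of "\<xi> * (t div p)"] by (simp add: mult.left_commute)
  then show ?thesis using True assms by simp
next
  case False
  let ?S = "\<Sum>\<xi>\<in>{0..<p}. add_char p (\<xi> * t)"
  have "?S = (\<Sum>\<xi>\<in>{0..<p}. add_char p ((\<xi> + 1) * t))"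
    by (rule sum_periodic_shift[OF assms, symmetric], rule add_char_cong[OF assms])
       (simp add: left_diff_distrib[symmetric] dvd_mult2 mod_eq_dvd_iff[symmetric])
  also have "\<dots> = ?S * add_char p t"
    by (simp add: ring_distribs add_char_add sum_distrib_right)
  finally have "?S = 0" using add_char_eq_1_imp[OF assms] False by auto
  then show ?thesis using False by simp
qed

lemma parseval_mod:
  fixes g :: "int \<Rightarrow> complex"
  assumes "0 < p"
  shows "(\<Sum>\<xi>\<in>{0..<p}. (norm (\<Sum>x\<in>{0..<p}. g x * add_char p (- (\<xi> * x))))\<^sup>2)
         = of_int p * (\<Sum>x\<in>{0..<p}. (norm (g x))\<^sup>2)"
proof -
  let ?I = "{0..<p}"
  have "complex_of_real (\<Sum>\<xi>\<in>?I. (norm (\<Sum>x\<in>?I. g x * add_char p (- (\<xi> * x))))\<^sup>2)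
      = (\<Sum>\<xi>\<in>?I. (\<Sum>x\<in>?I. g x * add_char p (- (\<xi> * x))) * cnj (\<Sum>y\<in>?I. g y * add_char p (- (\<xi> * y))))"
    by (simp only: of_real_sum complex_norm_square)
  also have "\<dots> = (\<Sum>\<xi>\<in>?I. \<Sum>x\<in>?I. \<Sum>y\<in>?I. g x * cnj (g y) * add_char p (\<xi> * (y - x)))"
    by (intro sum.cong refl)
       (simp add: sum_product cnj_add_char right_diff_distrib add_char_add[symmetric]
          diff_conv_add_uminus[symmetric] mult_ac)
  also have "\<dots> = (\<Sum>x\<in>?I. \<Sum>\<xi>\<in>?I. \<Sum>y\<in>?I. g x * cnj (g y) * add_char p (\<xi> * (y - x)))"
    by (rule sum.swap)
  also have "\<dots> = (\<Sum>x\<in>?I. \<Sum>y\<in>?I. \<Sum>\<xi>\<in>?I. g x * cnj (g y) * add_char p (\<xi> * (y - x)))"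
    by (rule sum.cong[OF refl], rule sum.swap)
  also have "\<dots> = (\<Sum>x\<in>?I. \<Sum>y\<in>?I. g x * cnj (g y) * (if y = x then of_int p else 0))"
  proof (intro sum.cong refl)
    fix x y assume "x \<in> ?I" "y \<in> ?I"
    then have "p dvd y - x \<longleftrightarrow> y = x"
      by (auto simp: mod_eq_dvd_iff[symmetric])
    then show "(\<Sum>\<xi>\<in>?I. g x * cnj (g y) * add_char p (\<xi> * (y - x)))
        = g x * cnj (g y) * (if y = x then of_int p else 0)"
      by (simp add: sum_distrib_left[symmetric] sum_add_char[OF assms])
  qed
  also have "\<dots> = (\<Sum>x\<in>?I. g x * cnj (g x) * of_int p)"
    by (intro sum.cong refl) (simp add: if_distrib cong: if_cong)
  also have "\<dots> = complex_of_real (of_int p * (\<Sum>x\<in>?I. (norm (g x))\<^sup>2))"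
    by (simp only: of_real_mult of_real_sum complex_norm_square sum_distrib_left of_real_of_int_eq mult_ac)
  finally show ?thesis by (simp only: of_real_eq_iff)
qed

definition fourier2 :: "int \<Rightarrow> (int \<Rightarrow> int \<Rightarrow> complex) \<Rightarrow> int \<Rightarrow> int \<Rightarrow> complex" where
  "fourier2 p \<phi> \<xi> \<eta> = (\<Sum>y\<in>{0..<p}. \<Sum>x\<in>{0..<p}. \<phi> x y * add_char p (- (\<xi> * x + \<eta> * y)))"

definition energy :: "int \<Rightarrow> (int \<Rightarrow> int \<Rightarrow> complex) \<Rightarrow> real" where
  "energy p \<phi> = (\<Sum>y\<in>{0..<p}. \<Sum>x\<in>{0..<p}. (norm (\<phi> x y))\<^sup>2)"

text \<open>The transform in two variables is the composition of transforms in each variable separately, so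
  the one-variable identity is applied twice.\<close>
lemma parseval_fourier2:
  assumes "0 < p"
  shows "energy p (\<lambda>\<xi> \<eta>. fourier2 p \<phi> \<xi> \<eta>) = (of_int p)\<^sup>2 * energy p \<phi>"
proof -
  let ?I = "{0..<p}"
  define \<psi> where "\<psi> \<xi> y = (\<Sum>x\<in>?I. \<phi> x y * add_char p (- (\<xi> * x)))" for \<xi> y
  have f: "fourier2 p \<phi> \<xi> \<eta> = (\<Sum>y\<in>?I. \<psi> \<xi> y * add_char p (- (\<eta> * y)))" for \<xi> \<eta>
    unfolding fourier2_def \<psi>_def sum_distrib_right
    by (simp add: add_char_add[symmetric] mult.assoc)
  have "energy p (\<lambda>\<xi> \<eta>. fourier2 p \<phi> \<xi> \<eta>)
      = (\<Sum>\<xi>\<in>?I. \<Sum>\<eta>\<in>?I. (norm (\<Sum>y\<in>?I. \<psi> \<xi> y * add_char p (- (\<eta> * y))))\<^sup>2)"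
    unfolding energy_def f by (rule sum.swap)
  also have "\<dots> = (\<Sum>\<xi>\<in>?I. of_int p * (\<Sum>y\<in>?I. (norm (\<psi> \<xi> y))\<^sup>2))"
    by (simp only: parseval_mod[OF assms])
  also have "\<dots> = of_int p * (\<Sum>y\<in>?I. \<Sum>\<xi>\<in>?I. (norm (\<psi> \<xi> y))\<^sup>2)"
    unfolding sum_distrib_left[symmetric] by (subst sum.swap) (rule refl)
  also have "\<dots> = (of_int p)\<^sup>2 * energy p \<phi>"
    unfolding \<psi>_def parseval_mod[OF assms] energy_def
    by (simp add: sum_distrib_left power2_eq_square mult_ac)
  finally show ?thesis .
qed

lemma sum_periodic_centred2:
  fixes h :: "int \<Rightarrow> int \<Rightarrow> 'a::comm_monoid_add"
  assumes "0 \<le> k" and "p = 2 * k + 1"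
    and "\<And>x y. h (x mod p) y = h x y" and "\<And>x y. h x (y mod p) = h x y"
  shows "(\<Sum>(x, y)\<in>{-k..k} \<times> {-k..k}. h x y) = (\<Sum>y\<in>{0..<p}. \<Sum>x\<in>{0..<p}. h x y)"
proof -
  have "(\<Sum>(x, y)\<in>{-k..k} \<times> {-k..k}. h x y) = (\<Sum>x\<in>{-k..k}. \<Sum>y\<in>{-k..k}. h x y)"
    by (simp add: sum.cartesian_product)
  also have "\<dots> = (\<Sum>x\<in>{-k..k}. \<Sum>y\<in>{0..<p}. h x y)"
    by (intro sum.cong refl sum_periodic_centred) (use assms in auto)
  also have "\<dots> = (\<Sum>x\<in>{0..<p}. \<Sum>y\<in>{0..<p}. h x y)"
    by (intro sum_periodic_centred) (use assms in auto)
  also have "\<dots> = (\<Sum>y\<in>{0..<p}. \<Sum>x\<in>{0..<p}. h x y)"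
    by (rule sum.swap)
  finally show ?thesis .
qed

lemma fourier2_swap: "fourier2 p (\<lambda>x y. \<phi> y x) \<xi> \<eta> = fourier2 p \<phi> \<eta> \<xi>"
  unfolding fourier2_def by (subst sum.swap) (simp add: add.commute)

lemma fourier2_diff:
  "fourier2 p (\<lambda>x y. \<phi> x y - \<psi> x y) \<xi> \<eta> = fourier2 p \<phi> \<xi> \<eta> - fourier2 p \<psi> \<xi> \<eta>"
  by (simp add: fourier2_def sum_subtractf left_diff_distrib)

lemma fourier2_periodic:
  assumes "0 < p"
  shows "fourier2 p \<phi> (\<xi> mod p) \<eta> = fourier2 p \<phi> \<xi> \<eta>" "fourier2 p \<phi> \<xi> (\<eta> mod p) = fourier2 p \<phi> \<xi> \<eta>"
proof -
  have 1: "p dvd - (\<xi> mod p * x + \<eta> * y) - - (\<xi> * x + \<eta> * y)" for x y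
  proof -
    have "- (\<xi> mod p * x + \<eta> * y) - - (\<xi> * x + \<eta> * y) = (\<xi> - \<xi> mod p) * x"
      by (simp add: left_diff_distrib)
    then show ?thesis by simp
  qed
  have 2: "p dvd - (\<xi> * x + \<eta> mod p * y) - - (\<xi> * x + \<eta> * y)" for x y
  proof -
    have "- (\<xi> * x + \<eta> mod p * y) - - (\<xi> * x + \<eta> * y) = (\<eta> - \<eta> mod p) * y"
      by (simp add: left_diff_distrib)
    then show ?thesis by simp
  qed
  show "fourier2 p \<phi> (\<xi> mod p) \<eta> = fourier2 p \<phi> \<xi> \<eta>" "fourier2 p \<phi> \<xi> (\<eta> mod p) = fourier2 p \<phi> \<xi> \<eta>"
    unfolding fourier2_def by (simp_all only: add_char_cong[OF assms 1] add_char_cong[OF assms 2])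
qed

text \<open>A shear of the argument becomes the contragredient shear of the frequency, and a translation
  becomes multiplication by a character. Both follow from one shift in the variable \<open>x\<close>, whose
  size may depend on \<open>y\<close>; shears in the other direction are reduced to this case by exchanging
  the coordinates.\<close>
lemma fourier2_shear:
  assumes "0 < p" and per: "\<And>x y. \<phi> (x mod p) y = \<phi> x y"
  shows "fourier2 p (\<lambda>x y. \<phi> (x + (c * y + d)) y) \<xi> \<eta>
         = add_char p (d * \<xi>) * fourier2 p \<phi> \<xi> (\<eta> - c * \<xi>)"
proof -
  let ?I = "{0..<p}"
  have "(\<Sum>x\<in>?I. \<phi> (x + (c * y + d)) y * add_char p (- (\<xi> * x + \<eta> * y)))
      = add_char p (d * \<xi>) * (\<Sum>x\<in>?I. \<phi> x y * add_char p (- (\<xi> * x + (\<eta> - c * \<xi>) * y)))" for y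
  proof -
    define h where "h x = \<phi> x y * add_char p (d * \<xi> - (\<xi> * x + (\<eta> - c * \<xi>) * y))" for x
    have "h (x mod p) = h x" for x
    proof -
      have "d * \<xi> - (\<xi> * (x mod p) + (\<eta> - c * \<xi>) * y) - (d * \<xi> - (\<xi> * x + (\<eta> - c * \<xi>) * y))
          = \<xi> * (x - x mod p)"
        by (simp add: right_diff_distrib)
      then have "p dvd d * \<xi> - (\<xi> * (x mod p) + (\<eta> - c * \<xi>) * y)
          - (d * \<xi> - (\<xi> * x + (\<eta> - c * \<xi>) * y))"
        by simp
      from add_char_cong[OF assms(1) this] show ?thesis by (simp only: h_def per)
    qed
    from sum_periodic_shift[of p h, OF assms(1) this]
    have "(\<Sum>x\<in>?I. h (x + (c * y + d))) = (\<Sum>x\<in>?I. h x)" .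
    moreover have "h (x + (c * y + d)) = \<phi> (x + (c * y + d)) y * add_char p (- (\<xi> * x + \<eta> * y))" for x
      unfolding h_def by (simp add: algebra_simps)
    moreover have "h x = add_char p (d * \<xi>) * (\<phi> x y * add_char p (- (\<xi> * x + (\<eta> - c * \<xi>) * y)))" for x
      unfolding h_def by (subst diff_conv_add_uminus, subst add_char_add) (simp add: mult_ac)
    ultimately show ?thesis by (simp only: sum_distrib_left)
  qed
  then show ?thesis by (simp add: fourier2_def sum_distrib_left)
qed

section \<open>Shear-invariant mass sits at the origin\<close>

text \<open>Closeness in \<open>\<ell>\<^sup>2\<close> of two families makes their squares close in \<open>\<ell>\<^sup>1\<close>: this is Cauchy--Schwarz for
  \<open>\<bar>s\<^sup>2 - r\<^sup>2\<bar> = \<bar>s - r\<bar> * (s + r)\<close>, in the weighted arithmetic-geometric form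
  \<open>d * t \<le> 25 * d\<^sup>2 + t\<^sup>2 / 100\<close>, which avoids square roots.\<close>
lemma sum_abs_diff_norm_squares_le:
  fixes a b :: "'i \<Rightarrow> complex"
  shows "(\<Sum>i\<in>A. \<bar>(norm (b i))\<^sup>2 - (norm (a i))\<^sup>2\<bar>)
    \<le> 25 * (\<Sum>i\<in>A. (norm (b i - a i))\<^sup>2) + ((\<Sum>i\<in>A. (norm (a i))\<^sup>2) + (\<Sum>i\<in>A. (norm (b i))\<^sup>2)) / 50"
proof -
  have "\<bar>s\<^sup>2 - r\<^sup>2\<bar> \<le> 25 * d\<^sup>2 + (r\<^sup>2 + s\<^sup>2) / 50" if "0 \<le> r" "0 \<le> s" "\<bar>s - r\<bar> \<le> d" for r s d :: real
  proof -
    have "\<bar>s\<^sup>2 - r\<^sup>2\<bar> = \<bar>s - r\<bar> * (s + r)"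
      using that by (simp add: power2_eq_square square_diff_square_factored abs_mult mult.commute)
    also have "\<dots> \<le> d * (s + r)" using that by (intro mult_right_mono) auto
    also have "\<dots> \<le> 25 * d\<^sup>2 + (s + r)\<^sup>2 / 100"
      using zero_le_power2[of "5 * d - (s + r) / 10"] by (simp add: power2_eq_square algebra_simps)
    also have "\<dots> \<le> 25 * d\<^sup>2 + (r\<^sup>2 + s\<^sup>2) / 50"
      using zero_le_power2[of "s - r"] by (simp add: power2_eq_square algebra_simps)
    finally show ?thesis .
  qed
  then have "(\<Sum>i\<in>A. \<bar>(norm (b i))\<^sup>2 - (norm (a i))\<^sup>2\<bar>)
      \<le> (\<Sum>i\<in>A. 25 * (norm (b i - a i))\<^sup>2 + ((norm (a i))\<^sup>2 + (norm (b i))\<^sup>2) / 50)"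
    by (intro sum_mono) (simp add: norm_triangle_ineq3)
  also have "\<dots> = 25 * (\<Sum>i\<in>A. (norm (b i - a i))\<^sup>2) + ((\<Sum>i\<in>A. (norm (a i))\<^sup>2) + (\<Sum>i\<in>A. (norm (b i))\<^sup>2)) / 50"
    by (simp add: sum.distrib sum_distrib_left sum_divide_distrib add_divide_distrib)
  finally show ?thesis .
qed

text \<open>One of two half-open double cones, exchanged by a quarter turn, that partition the nonzero
  lattice vectors. Which boundary ray belongs to which cone is chosen so that the cone is the exact
  disjoint union of its images under the two positive shears.\<close>
definition pos_cone :: "(int \<times> int) set" where
  "pos_cone = {(\<xi>, \<eta>). 0 < \<xi> \<and> 0 \<le> \<eta> \<or> \<xi> < 0 \<and> \<eta> \<le> 0}"

definition square :: "int \<Rightarrow> (int \<times> int) set" where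
  "square k = {-k..k} \<times> {-k..k}"

text \<open>On these frequencies a sum of two coordinates stays in \<open>{-k..k}\<close>, so that shearing needs no
  reduction modulo \<open>2 * k + 1\<close>.\<close>
definition half_square :: "int \<Rightarrow> (int \<times> int) set" where
  "half_square k = {(\<xi>, \<eta>). 2 * \<bar>\<xi>\<bar> \<le> k \<and> 2 * \<bar>\<eta>\<bar> \<le> k}"

lemma finite_square [simp]: "finite (square k)"
  by (simp add: square_def)

lemma half_square_subset: "half_square k \<subseteq> square k"
  by (auto simp: half_square_def square_def)

text \<open>The two shears map the small vectors of the cone to disjoint subsets of the cone, each of nearly the
  same mass as the original. Hence twice the mass of the small vectors is at most the mass of the
  whole cone, up to \<open>2 * \<theta>\<close>, and the two differ only by frequencies that are not small.\<close>
lemma mass_pos_cone_le: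
  fixes m :: "int \<Rightarrow> int \<Rightarrow> real"
  assumes nonneg: "\<And>\<xi> \<eta>. 0 \<le> m \<xi> \<eta>"
    and vert: "(\<Sum>(\<xi>, \<eta>)\<in>square k. \<bar>m \<xi> (\<eta> - \<xi>) - m \<xi> \<eta>\<bar>) \<le> \<theta>"
    and horiz: "(\<Sum>(\<xi>, \<eta>)\<in>square k. \<bar>m (\<xi> - \<eta>) \<eta> - m \<xi> \<eta>\<bar>) \<le> \<theta>"
  shows "(\<Sum>(\<xi>, \<eta>)\<in>pos_cone \<inter> half_square k. m \<xi> \<eta>)
         \<le> 2 * \<theta> + (\<Sum>(\<xi>, \<eta>)\<in>square k - half_square k. m \<xi> \<eta>)"
proof -
  let ?C = "pos_cone \<inter> half_square k" and ?m = "\<lambda>(\<xi>, \<eta>). m \<xi> \<eta>"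
  define S1 where "S1 = (\<lambda>(\<xi>, \<eta>). (\<xi>, \<xi> + \<eta>)) ` ?C"
  define S2 where "S2 = (\<lambda>(\<xi>, \<eta>). (\<xi> + \<eta>, \<eta>)) ` ?C"
  have S1: "S1 \<subseteq> square k" and S2: "S2 \<subseteq> square k"
    by (auto simp: S1_def S2_def square_def half_square_def)
  have fin: "finite ?C" "finite S1" "finite S2"
    using half_square_subset finite_subset[OF _ finite_square] S1 S2 by blast+
  have dis: "S1 \<inter> S2 = {}" by (auto simp: S1_def S2_def pos_cone_def)
  have sub: "S1 \<union> S2 \<subseteq> ?C \<union> (square k - half_square k)"
  proof -
    have "S1 \<union> S2 \<subseteq> pos_cone" by (auto simp: S1_def S2_def pos_cone_def)
    with S1 S2 show ?thesis by blast
  qed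
  have "(\<Sum>z\<in>?C. ?m z) = (\<Sum>(\<xi>, \<eta>)\<in>S1. m \<xi> (\<eta> - \<xi>))"
    unfolding S1_def by (subst sum.reindex) (auto simp: inj_on_def intro!: sum.cong)
  also have "\<dots> \<le> (\<Sum>(\<xi>, \<eta>)\<in>S1. \<bar>m \<xi> (\<eta> - \<xi>) - m \<xi> \<eta>\<bar> + m \<xi> \<eta>)"
    by (intro sum_mono) auto
  also have "\<dots> = (\<Sum>(\<xi>, \<eta>)\<in>S1. \<bar>m \<xi> (\<eta> - \<xi>) - m \<xi> \<eta>\<bar>) + (\<Sum>z\<in>S1. ?m z)"
    by (simp add: sum.distrib case_prod_unfold)
  also have "(\<Sum>(\<xi>, \<eta>)\<in>S1. \<bar>m \<xi> (\<eta> - \<xi>) - m \<xi> \<eta>\<bar>) \<le> \<theta>"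
    by (rule order_trans[OF sum_mono2 vert]) (use S1 in auto)
  finally have 1: "(\<Sum>z\<in>?C. ?m z) \<le> \<theta> + (\<Sum>z\<in>S1. ?m z)" by simp
  have "(\<Sum>z\<in>?C. ?m z) = (\<Sum>(\<xi>, \<eta>)\<in>S2. m (\<xi> - \<eta>) \<eta>)"
    unfolding S2_def by (subst sum.reindex) (auto simp: inj_on_def intro!: sum.cong)
  also have "\<dots> \<le> (\<Sum>(\<xi>, \<eta>)\<in>S2. \<bar>m (\<xi> - \<eta>) \<eta> - m \<xi> \<eta>\<bar> + m \<xi> \<eta>)"
    by (intro sum_mono) auto
  also have "\<dots> = (\<Sum>(\<xi>, \<eta>)\<in>S2. \<bar>m (\<xi> - \<eta>) \<eta> - m \<xi> \<eta>\<bar>) + (\<Sum>z\<in>S2. ?m z)"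
    by (simp add: sum.distrib case_prod_unfold)
  also have "(\<Sum>(\<xi>, \<eta>)\<in>S2. \<bar>m (\<xi> - \<eta>) \<eta> - m \<xi> \<eta>\<bar>) \<le> \<theta>"
    by (rule order_trans[OF sum_mono2 horiz]) (use S2 in auto)
  finally have 2: "(\<Sum>z\<in>?C. ?m z) \<le> \<theta> + (\<Sum>z\<in>S2. ?m z)" by simp
  have "(\<Sum>z\<in>S1. ?m z) + (\<Sum>z\<in>S2. ?m z) = (\<Sum>z\<in>S1 \<union> S2. ?m z)"
    by (rule sum.union_disjoint[symmetric]) (use fin dis in auto)
  also have "\<dots> \<le> (\<Sum>z\<in>?C \<union> (square k - half_square k). ?m z)"
    by (rule sum_mono2) (use sub fin nonneg in auto)
  also have "\<dots> = (\<Sum>z\<in>?C. ?m z) + (\<Sum>z\<in>square k - half_square k. ?m z)"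
    by (rule sum.union_disjoint) (use fin in auto)
  finally show ?thesis using 1 2 by simp
qed

lemma sum_union_le:
  fixes f :: "'i \<Rightarrow> real"
  assumes "finite A" and "finite B" and "\<And>i. 0 \<le> f i"
  shows "sum f (A \<union> B) \<le> sum f A + sum f B"
  using assms sum_Un[of A B f] by (simp add: sum_nonneg)

text \<open>Every small nonzero frequency lies in the cone or in its image under a quarter turn. The quarter turn
  conjugates the positive shears to the inverse shears, so the bound for the cone applies to the
  rotated mass as well.\<close>
lemma mass_origin_ge:
  fixes m :: "int \<Rightarrow> int \<Rightarrow> real"
  assumes nonneg: "\<And>\<xi> \<eta>. 0 \<le> m \<xi> \<eta>"
    and vert: "\<And>c. c \<in> {1, -1} \<Longrightarrow> (\<Sum>(\<xi>, \<eta>)\<in>square k. \<bar>m \<xi> (\<eta> - c * \<xi>) - m \<xi> \<eta>\<bar>) \<le> \<theta>"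
    and horiz: "\<And>c. c \<in> {1, -1} \<Longrightarrow> (\<Sum>(\<xi>, \<eta>)\<in>square k. \<bar>m (\<xi> - c * \<eta>) \<eta> - m \<xi> \<eta>\<bar>) \<le> \<theta>"
  shows "(\<Sum>(\<xi>, \<eta>)\<in>square k. m \<xi> \<eta>)
         \<le> m 0 0 + 4 * \<theta> + 3 * (\<Sum>(\<xi>, \<eta>)\<in>square k - half_square k. m \<xi> \<eta>)"
proof -
  let ?m = "\<lambda>(\<xi>, \<eta>). m \<xi> \<eta>"
  let ?C = "pos_cone \<inter> half_square k" and ?R = "square k - half_square k"
  define r where "r = (\<lambda>(\<xi> :: int, \<eta> :: int). (- \<eta>, \<xi>))"
  have inj: "inj_on r A" for A by (auto simp: r_def inj_on_def)
  have rot: "(\<Sum>(\<xi>, \<eta>)\<in>A. h (- \<eta>) \<xi>) = (\<Sum>(\<xi>, \<eta>)\<in>r ` A. h \<xi> \<eta>)" for A and h :: "int \<Rightarrow> int \<Rightarrow> real"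
    by (subst sum.reindex[OF inj]) (auto simp: r_def intro!: sum.cong)
  have rsq: "r ` square k = square k"
  proof
    show "r ` square k \<subseteq> square k" by (auto simp: r_def square_def)
    show "square k \<subseteq> r ` square k"
    proof
      fix z assume "z \<in> square k"
      then have "z = r (snd z, - fst z)" "(snd z, - fst z) \<in> square k"
        by (auto simp: r_def square_def)
      then show "z \<in> r ` square k" by blast
    qed
  qed
  have rhalf: "r ` (square k - half_square k) = square k - half_square k"
  proof -
    have "r ` half_square k = half_square k"
    proof
      show "r ` half_square k \<subseteq> half_square k" by (auto simp: r_def half_square_def)
      show "half_square k \<subseteq> r ` half_square k"
      proof
        fix z assume "z \<in> half_square k"
        then have "z = r (snd z, - fst z)" "(snd z, - fst z) \<in> half_square k"
          by (auto simp: r_def half_square_def)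
        then show "z \<in> r ` half_square k" by blast
      qed
    qed
    then show ?thesis by (simp add: image_set_diff[OF inj] rsq)
  qed
  have pos: "(\<Sum>z\<in>?C. ?m z) \<le> 2 * \<theta> + (\<Sum>z\<in>?R. ?m z)"
    using mass_pos_cone_le[of m k \<theta>] nonneg vert[of 1] horiz[of 1] by simp
  have "(\<Sum>(\<xi>, \<eta>)\<in>?C. m (- \<eta>) \<xi>) \<le> 2 * \<theta> + (\<Sum>(\<xi>, \<eta>)\<in>?R. m (- \<eta>) \<xi>)"
  proof (rule mass_pos_cone_le)
    show "(\<Sum>(\<xi>, \<eta>)\<in>square k. \<bar>m (- (\<eta> - \<xi>)) \<xi> - m (- \<eta>) \<xi>\<bar>) \<le> \<theta>"
      using horiz[of "-1"] rot[of "\<lambda>\<xi> \<eta>. \<bar>m (\<xi> + \<eta>) \<eta> - m \<xi> \<eta>\<bar>" "square k"] by (simp add: rsq)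
    show "(\<Sum>(\<xi>, \<eta>)\<in>square k. \<bar>m (- \<eta>) (\<xi> - \<eta>) - m (- \<eta>) \<xi>\<bar>) \<le> \<theta>"
      using vert[of "-1"] rot[of "\<lambda>\<xi> \<eta>. \<bar>m \<xi> (\<eta> + \<xi>) - m \<xi> \<eta>\<bar>" "square k"] by (simp add: rsq)
  qed (rule nonneg)
  then have neg: "(\<Sum>z\<in>r ` ?C. ?m z) \<le> 2 * \<theta> + (\<Sum>z\<in>?R. ?m z)"
    by (simp only: rot rhalf)
  have fin: "finite ?C" "finite (r ` ?C)"
    using half_square_subset finite_subset[OF _ finite_square] by blast+
  (* A vector outside the cone lies in the turned cone: its preimage under the turn is in the cone. *)
  have cover: "square k \<subseteq> {(0, 0)} \<union> ?C \<union> r ` ?C \<union> ?R"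
  proof
    fix z assume z: "z \<in> square k"
    obtain \<xi> \<eta> where [simp]: "z = (\<xi>, \<eta>)" by fastforce
    have "z = r (\<eta>, - \<xi>)" by (simp add: r_def)
    moreover have "(\<eta>, - \<xi>) \<in> ?C" if "z \<in> half_square k" "z \<noteq> (0, 0)" "z \<notin> pos_cone"
      using that by (auto simp: pos_cone_def half_square_def)
    ultimately show "z \<in> {(0, 0)} \<union> ?C \<union> r ` ?C \<union> ?R" using z by blast
  qed
  have nonneg': "0 \<le> ?m z" for z using nonneg by (simp add: case_prod_unfold)
  have "(\<Sum>z\<in>square k. ?m z) \<le> (\<Sum>z\<in>{(0, 0)} \<union> ?C \<union> r ` ?C \<union> ?R. ?m z)"
    by (rule sum_mono2) (use fin cover nonneg in auto)
  also have "\<dots> \<le> (\<Sum>z\<in>{(0, 0)}. ?m z) + (\<Sum>z\<in>?C. ?m z) + (\<Sum>z\<in>r ` ?C. ?m z) + (\<Sum>z\<in>?R. ?m z)"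
    using fin by (intro order_trans[OF sum_union_le] add_mono order_refl nonneg') auto
  finally show ?thesis using pos neg by simp
qed

section \<open>Almost invariant functions are almost constant\<close>

text \<open>For \<open>\<bar>\<xi>\<bar> > k / 2\<close> the angle \<open>2 \<pi> \<bar>\<xi>\<bar> / p\<close> lies between \<open>\<pi> / 2\<close> and \<open>\<pi>\<close>, so its cosine is not positive.\<close>
lemma norm_add_char_minus_1:
  assumes p: "p = 2 * k + 1" and "\<bar>\<xi>\<bar> \<le> k" and "k < 2 * \<bar>\<xi>\<bar>"
  shows "2 \<le> (norm (add_char p \<xi> - 1))\<^sup>2"
proof -
  define t where "t = 2 * pi * real_of_int \<bar>\<xi>\<bar> / real_of_int p"
  have pp: "0 < real_of_int p" using assms by linarith
  have "4 * real_of_int \<bar>\<xi>\<bar> \<ge> real_of_int p" "2 * real_of_int \<bar>\<xi>\<bar> \<le> real_of_int p"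
    using assms by linarith+
  then have "pi / 2 \<le> t" "t \<le> pi"
    using pp mult_left_mono[of _ _ pi] unfolding t_def by (auto simp: field_simps)
  then have c: "cos t \<le> 0"
    using cos_monotone_0_pi_le[of "pi / 2" t] by simp
  have ct: "cos (2 * pi * real_of_int \<xi> / real_of_int p) = cos t"
    unfolding t_def by (cases "\<xi> \<ge> 0") (auto simp: abs_if)
  have "(norm (add_char p \<xi> - 1))\<^sup>2 = (cos t - 1)\<^sup>2 + (sin (2 * pi * real_of_int \<xi> / real_of_int p))\<^sup>2"
    by (simp add: add_char_def cmod_power2 ct)
  also have "\<dots> = 2 - 2 * cos t"
    using sin_cos_squared_add[of "2 * pi * real_of_int \<xi> / real_of_int p"]
    by (simp add: ct power2_diff)
  finally show ?thesis using c by simp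
qed


lemma fourier_mass_total:
  assumes "0 \<le> k" and "p = 2 * k + 1"
  shows "(\<Sum>(\<xi>, \<eta>)\<in>square k. (norm (fourier2 p \<phi> \<xi> \<eta>))\<^sup>2) = (of_int p)\<^sup>2 * energy p \<phi>"
proof -
  have p0: "0 < p" using assms by simp
  have "(\<Sum>(\<xi>, \<eta>)\<in>square k. (norm (fourier2 p \<phi> \<xi> \<eta>))\<^sup>2) = energy p (\<lambda>\<xi> \<eta>. fourier2 p \<phi> \<xi> \<eta>)"
    unfolding energy_def square_def
    by (rule sum_periodic_centred2[OF assms]) (simp_all only: fourier2_periodic[OF p0])
  then show ?thesis by (simp only: parseval_fourier2[OF p0])
qed

lemma energy_swap: "energy p (\<lambda>x y. f y x) = energy p f"
  unfolding energy_def by (rule sum.swap)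

lemma energy_shear:
  assumes "0 < p" and "\<And>x y. \<phi> (x mod p) y = \<phi> x y"
  shows "energy p (\<lambda>x y. \<phi> (x + c * y) y) = energy p \<phi>"
  unfolding energy_def
  by (intro sum.cong refl sum_periodic_shift assms(1)) (simp add: assms(2))

text \<open>The constant is \<open>25 / 1000 + 2 / 50 = 13 / 200\<close>: the first summand comes from the distance
  between the function and its shear, the second from their total energies.\<close>
lemma fourier_mass_shear:
  assumes "0 \<le> k" and p: "p = 2 * k + 1" and per: "\<And>x y. \<phi> (x mod p) y = \<phi> x y"
    and inv: "energy p (\<lambda>x y. \<phi> (x + c * y) y - \<phi> x y) \<le> energy p \<phi> / 1000"
  shows "(\<Sum>(\<xi>, \<eta>)\<in>square k. \<bar>(norm (fourier2 p \<phi> \<xi> (\<eta> - c * \<xi>)))\<^sup>2 - (norm (fourier2 p \<phi> \<xi> \<eta>))\<^sup>2\<bar>)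
         \<le> 13 / 200 * ((of_int p)\<^sup>2 * energy p \<phi>)"
proof -
  have p0: "0 < p" using assms by simp
  define \<psi> where "\<psi> = (\<lambda>x y. \<phi> (x + c * y) y)"
  have hat: "fourier2 p \<psi> \<xi> \<eta> = fourier2 p \<phi> \<xi> (\<eta> - c * \<xi>)" for \<xi> \<eta>
    using fourier2_shear[where p = p and \<phi> = \<phi>, OF p0 per, where d = 0] by (simp add: \<psi>_def)
  note sum_eq = fourier_mass_total[OF assms(1,2)]
  have "(\<Sum>z\<in>square k. \<bar>(norm (case z of (\<xi>, \<eta>) \<Rightarrow> fourier2 p \<psi> \<xi> \<eta>))\<^sup>2 - (norm (case z of (\<xi>, \<eta>) \<Rightarrow> fourier2 p \<phi> \<xi> \<eta>))\<^sup>2\<bar>)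
    \<le> 25 * ((of_int p)\<^sup>2 * energy p (\<lambda>x y. \<psi> x y - \<phi> x y))
      + ((of_int p)\<^sup>2 * energy p \<phi> + (of_int p)\<^sup>2 * energy p \<psi>) / 50"
    unfolding sum_eq[symmetric] fourier2_diff
    by (rule order_trans[OF sum_abs_diff_norm_squares_le]) (simp add: case_prod_unfold)
  also have "energy p \<psi> = energy p \<phi>"
    unfolding \<psi>_def by (rule energy_shear[where \<phi> = \<phi>, OF p0 per])
  also have "25 * ((of_int p)\<^sup>2 * energy p (\<lambda>x y. \<psi> x y - \<phi> x y)) \<le> 25 * ((of_int p)\<^sup>2 * (energy p \<phi> / 1000))"
    using inv by (intro mult_left_mono) (auto simp: \<psi>_def)
  finally show ?thesis by (simp add: hat case_prod_unfold mult.commute)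
qed

text \<open>Translation by one unit multiplies the transform by \<open>add_char p \<xi>\<close>, which is far from \<open>1\<close> when \<open>\<xi>\<close> is
  large; an almost invariant function therefore has little mass there.\<close>
lemma fourier_mass_translation:
  assumes "0 \<le> k" and p: "p = 2 * k + 1" and per: "\<And>x y. \<phi> (x mod p) y = \<phi> x y"
    and inv: "energy p (\<lambda>x y. \<phi> (x + 1) y - \<phi> x y) \<le> energy p \<phi> / 1000"
  shows "(\<Sum>(\<xi>, \<eta>)\<in>square k \<inter> {(\<xi>, \<eta>). k < 2 * \<bar>\<xi>\<bar>}. (norm (fourier2 p \<phi> \<xi> \<eta>))\<^sup>2)
         \<le> (of_int p)\<^sup>2 * energy p \<phi> / 2000"
proof -
  have p0: "0 < p" using assms by simp
  let ?A = "square k \<inter> {(\<xi>, \<eta>). k < 2 * \<bar>\<xi>\<bar>}"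
  define \<psi> where "\<psi> = (\<lambda>x y. \<phi> (x + 1) y - \<phi> x y)"
  have hat: "fourier2 p \<psi> \<xi> \<eta> = (add_char p \<xi> - 1) * fourier2 p \<phi> \<xi> \<eta>" for \<xi> \<eta>
    using fourier2_shear[where p = p and \<phi> = \<phi>, OF p0 per, where c = 0 and d = 1]
    by (simp add: \<psi>_def fourier2_diff left_diff_distrib)
  have "2 * (\<Sum>(\<xi>, \<eta>)\<in>?A. (norm (fourier2 p \<phi> \<xi> \<eta>))\<^sup>2) \<le> (\<Sum>(\<xi>, \<eta>)\<in>?A. (norm (fourier2 p \<psi> \<xi> \<eta>))\<^sup>2)"
    unfolding sum_distrib_left
    by (intro sum_mono)
       (auto simp: hat norm_mult power_mult_distrib square_def
             intro!: mult_right_mono norm_add_char_minus_1[OF p])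
  also have "\<dots> \<le> (\<Sum>(\<xi>, \<eta>)\<in>square k. (norm (fourier2 p \<psi> \<xi> \<eta>))\<^sup>2)"
    by (rule sum_mono2) auto
  also have "\<dots> = (of_int p)\<^sup>2 * energy p \<psi>"
    by (rule fourier_mass_total[OF assms(1,2)])
  also have "\<dots> \<le> (of_int p)\<^sup>2 * (energy p \<phi> / 1000)"
    using inv by (intro mult_left_mono) (auto simp: \<psi>_def)
  finally show ?thesis by simp
qed

text \<open>The spectral gap of the affine action on the torus. Of the total mass, at most \<open>1 / 1000\<close> lies
  outside the half square and at most \<open>4 * 13 / 200 + 3 / 1000 < 1 / 2\<close> away from frequency zero, and the
  transform at frequency zero is the sum of the function.\<close>
lemma almost_invariant_imp_large_sum:
  fixes \<phi> :: "int \<Rightarrow> int \<Rightarrow> complex"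
  assumes k: "0 \<le> k" and p: "p = 2 * k + 1"
    and per: "\<And>x y. \<phi> (x mod p) y = \<phi> x y" "\<And>x y. \<phi> x (y mod p) = \<phi> x y"
    and trans: "energy p (\<lambda>x y. \<phi> (x + 1) y - \<phi> x y) \<le> energy p \<phi> / 1000"
      "energy p (\<lambda>x y. \<phi> x (y + 1) - \<phi> x y) \<le> energy p \<phi> / 1000"
    and shear: "\<And>c. c \<in> {1, -1} \<Longrightarrow> energy p (\<lambda>x y. \<phi> (x + c * y) y - \<phi> x y) \<le> energy p \<phi> / 1000"
      "\<And>c. c \<in> {1, -1} \<Longrightarrow> energy p (\<lambda>x y. \<phi> x (y + c * x) - \<phi> x y) \<le> energy p \<phi> / 1000"
  shows "(of_int p)\<^sup>2 * energy p \<phi> / 2 \<le> (norm (\<Sum>y\<in>{0..<p}. \<Sum>x\<in>{0..<p}. \<phi> x y))\<^sup>2"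
proof -
  have p0: "0 < p" using k p by simp
  define m where "m \<xi> \<eta> = (norm (fourier2 p \<phi> \<xi> \<eta>))\<^sup>2" for \<xi> \<eta>
  define M where "M = (of_int p)\<^sup>2 * energy p \<phi>"
  have flip: "fourier2 p (\<lambda>x y. \<phi> y x) \<xi> \<eta> = fourier2 p \<phi> \<eta> \<xi>" for \<xi> \<eta>
    by (rule fourier2_swap)
  have eflip: "energy p (\<lambda>x y. \<phi> y x) = energy p \<phi>"
    by (rule energy_swap)
  have total: "(\<Sum>(\<xi>, \<eta>)\<in>square k. m \<xi> \<eta>) = M"
    unfolding m_def M_def by (rule fourier_mass_total[OF k p])
  have swapped_sum: "(\<Sum>(\<xi>, \<eta>)\<in>A. h \<xi> \<eta>) = (\<Sum>(\<xi>, \<eta>)\<in>prod.swap ` A. h \<eta> \<xi>)"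
    for A and h :: "int \<Rightarrow> int \<Rightarrow> real"
    by (subst sum.reindex) (auto simp: case_prod_unfold)
  have swap_square: "prod.swap ` square k = square k"
    by (simp add: square_def product_swap)
  have vert: "(\<Sum>(\<xi>, \<eta>)\<in>square k. \<bar>m \<xi> (\<eta> - c * \<xi>) - m \<xi> \<eta>\<bar>) \<le> 13 / 200 * M" if "c \<in> {1, -1}" for c
    using fourier_mass_shear[OF k p per(1) shear(1)[OF that]] by (simp add: m_def M_def)
  have horiz: "(\<Sum>(\<xi>, \<eta>)\<in>square k. \<bar>m (\<xi> - c * \<eta>) \<eta> - m \<xi> \<eta>\<bar>) \<le> 13 / 200 * M" if "c \<in> {1, -1}" for c
  proof -
    have "energy p (\<lambda>x y. \<phi> y (x + c * y) - \<phi> y x) \<le> energy p (\<lambda>x y. \<phi> y x) / 1000"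
      using shear(2)[OF that] energy_swap[of p "\<lambda>x y. \<phi> x (y + c * x) - \<phi> x y"]
      by (simp only: eflip)
    from fourier_mass_shear[OF k p per(2) this]
    show ?thesis
      by (subst swapped_sum) (simp only: swap_square flip eflip m_def M_def)
  qed
  have nonneg: "0 \<le> m \<xi> \<eta>" for \<xi> \<eta> by (simp add: m_def)
  have "M \<le> m 0 0 + 4 * (13 / 200 * M) + 3 * (\<Sum>(\<xi>, \<eta>)\<in>square k - half_square k. m \<xi> \<eta>)"
    using mass_origin_ge[where m = m, OF nonneg vert horiz] by (simp only: total)
  moreover have "(\<Sum>(\<xi>, \<eta>)\<in>square k - half_square k. m \<xi> \<eta>) \<le> M / 1000"
  proof -
    let ?A = "square k \<inter> {(\<xi>, \<eta>). k < 2 * \<bar>\<xi>\<bar>}"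
    have A: "(\<Sum>(\<xi>, \<eta>)\<in>?A. m \<xi> \<eta>) \<le> M / 2000"
      using fourier_mass_translation[OF k p per(1) trans(1)] by (simp add: m_def M_def)
    have "energy p (\<lambda>x y. \<phi> y (x + 1) - \<phi> y x) \<le> energy p (\<lambda>x y. \<phi> y x) / 1000"
      using trans(2) energy_swap[of p "\<lambda>x y. \<phi> x (y + 1) - \<phi> x y"]
      by (simp only: eflip)
    from fourier_mass_translation[OF k p per(2) this]
    have B: "(\<Sum>(\<xi>, \<eta>)\<in>prod.swap ` ?A. m \<xi> \<eta>) \<le> M / 2000"
      by (subst swapped_sum[symmetric]) (simp only: flip eflip m_def M_def)
    have fin: "finite ?A" "finite (prod.swap ` ?A)" by auto
    have cover: "square k - half_square k \<subseteq> ?A \<union> prod.swap ` ?A"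
    proof
      fix z assume z: "z \<in> square k - half_square k"
      have "z = prod.swap (prod.swap z)" by simp
      moreover have "z \<in> ?A \<or> prod.swap z \<in> ?A"
        using z by (auto simp: half_square_def square_def)
      ultimately show "z \<in> ?A \<union> prod.swap ` ?A" by (metis Un_iff imageI)
    qed
    have "(\<Sum>(\<xi>, \<eta>)\<in>square k - half_square k. m \<xi> \<eta>) \<le> (\<Sum>(\<xi>, \<eta>)\<in>?A \<union> prod.swap ` ?A. m \<xi> \<eta>)"
      by (rule sum_mono2[OF finite_UnI[OF fin] cover]) (simp add: nonneg case_prod_unfold)
    also have "\<dots> \<le> (\<Sum>(\<xi>, \<eta>)\<in>?A. m \<xi> \<eta>) + (\<Sum>(\<xi>, \<eta>)\<in>prod.swap ` ?A. m \<xi> \<eta>)"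
      by (rule sum_union_le[OF fin]) (simp add: nonneg case_prod_unfold)
    finally show ?thesis using A B by simp
  qed
  moreover have "0 \<le> M" by (simp add: M_def energy_def sum_nonneg)
  ultimately have "M / 2 \<le> m 0 0" by simp
  then show ?thesis by (simp add: m_def M_def fourier2_def)
qed

section \<open>The affine group of the integer lattice\<close>

type_synonym affine = "int \<times> int \<times> int \<times> int \<times> int \<times> int"

text \<open>The tuple \<open>(a, b, c, d, u, v)\<close> stands for the affine map
  \<open>(x, y) \<mapsto> (a x + b y + u, c x + d y + v)\<close>.\<close>
fun linear_det :: "affine \<Rightarrow> int" where
  "linear_det (a, b, c, d, u, v) = a * d - b * c"

fun compose_affine :: "affine \<Rightarrow> affine \<Rightarrow> affine" where
  "compose_affine (a, b, c, d, u, v) (a', b', c', d', u', v') =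
     (a * a' + b * c', a * b' + b * d', c * a' + d * c', c * b' + d * d',
      a * u' + b * v' + u, c * u' + d * v' + v)"

definition id_affine :: affine where "id_affine = (1, 0, 0, 1, 0, 0)"

definition affine_group :: "nat monoid" where
  "affine_group = \<lparr>carrier = to_nat ` {g. \<bar>linear_det g\<bar> = 1},
     mult = (\<lambda>m n. to_nat (compose_affine (from_nat m) (from_nat n))),
     one = to_nat id_affine\<rparr>"

lemma det_compose: "linear_det (compose_affine g h) = linear_det g * linear_det h"
  by (cases g rule: linear_det.cases, cases h rule: linear_det.cases) (simp add: algebra_simps)

lemma det_id [simp]: "linear_det id_affine = 1"
  by (simp add: id_affine_def)

lemma compose_affine_assoc:
  "compose_affine (compose_affine g h) k = compose_affine g (compose_affine h k)"
  by (cases g rule: linear_det.cases, cases h rule: linear_det.cases, cases k rule: linear_det.cases)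
     (simp add: algebra_simps)

lemma compose_id: "compose_affine id_affine g = g"
  by (cases g rule: linear_det.cases) (simp add: id_affine_def)

text \<open>The inverse is given by the adjugate matrix divided by the determinant \<open>e\<close>; as \<open>e * e = 1\<close>, dividing
  by \<open>e\<close> is the same as multiplying by it.\<close>
lemma inverse_affine:
  assumes "\<bar>linear_det g\<bar> = 1"
  obtains h where "\<bar>linear_det h\<bar> = 1" "compose_affine h g = id_affine"
proof -
  obtain a b c d u v where g: "g = (a, b, c, d, u, v)" by (cases g rule: linear_det.cases)
  define e where "e = a * d - b * c"
  have e: "e * e = 1" "e * (a * d) = 1 + e * (b * c)"
  proof -
    have "\<bar>e\<bar> = 1" using assms by (simp add: g e_def)
    then have "e = 1 \<or> e = -1" by linarith
    then show "e * e = 1" by auto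
    then show "e * (a * d) = 1 + e * (b * c)" by (simp add: e_def algebra_simps)
  qed
  define h where "h = (e * d, - (e * b), - (e * c), e * a, e * (b * v - d * u), e * (c * u - a * v))"
  have "compose_affine h g = id_affine"
    using e by (simp add: h_def g id_affine_def algebra_simps)
  moreover from this have "\<bar>linear_det h\<bar> * \<bar>linear_det g\<bar> = 1"
    using det_compose[of h g] by (simp add: abs_mult[symmetric])
  ultimately show ?thesis using that assms by simp
qed

lemma affine_group_simps [simp]:
  "to_nat g \<in> carrier affine_group \<longleftrightarrow> \<bar>linear_det g\<bar> = 1"
  "to_nat g \<otimes>\<^bsub>affine_group\<^esub> to_nat h = to_nat (compose_affine g h)"
  "\<one>\<^bsub>affine_group\<^esub> = to_nat id_affine"
  unfolding affine_group_def by (simp_all add: inj_image_mem_iff)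

lemma affine_group_elemE:
  assumes "n \<in> carrier affine_group"
  obtains g where "n = to_nat g" "\<bar>linear_det g\<bar> = 1"
  using assms unfolding affine_group_def by auto

lemma group_affine_group: "group affine_group"
proof (rule groupI)
  fix x y assume "x \<in> carrier affine_group" "y \<in> carrier affine_group"
  then show "x \<otimes>\<^bsub>affine_group\<^esub> y \<in> carrier affine_group"
    by (elim affine_group_elemE) (simp add: det_compose abs_mult)
next
  fix x y z
  assume "x \<in> carrier affine_group" "y \<in> carrier affine_group" "z \<in> carrier affine_group"
  then show "x \<otimes>\<^bsub>affine_group\<^esub> y \<otimes>\<^bsub>affine_group\<^esub> z = x \<otimes>\<^bsub>affine_group\<^esub> (y \<otimes>\<^bsub>affine_group\<^esub> z)"
    by (elim affine_group_elemE) (simp add: compose_affine_assoc)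
next
  fix x assume "x \<in> carrier affine_group"
  then obtain g where g: "x = to_nat g" "\<bar>linear_det g\<bar> = 1" by (rule affine_group_elemE)
  then show "\<one>\<^bsub>affine_group\<^esub> \<otimes>\<^bsub>affine_group\<^esub> x = x" by (simp add: compose_id)
  from inverse_affine[OF g(2)] obtain h where h: "\<bar>linear_det h\<bar> = 1" "compose_affine h g = id_affine" .
  then show "\<exists>y\<in>carrier affine_group. y \<otimes>\<^bsub>affine_group\<^esub> x = \<one>\<^bsub>affine_group\<^esub>"
    by (intro bexI[of _ "to_nat h"]) (simp_all add: g)
qed simp

section \<open>Its action on the points of a torus modulo a prime\<close>

fun move :: "int \<Rightarrow> affine \<Rightarrow> int \<times> int \<Rightarrow> int \<times> int" where
  "move p (a, b, c, d, u, v) (x, y) = ((a * x + b * y + u) mod p, (c * x + d * y + v) mod p)"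

definition torus :: "int \<Rightarrow> (int \<times> int) set" where
  "torus p = {0..<p} \<times> {0..<p}"

lemma finite_torus [simp]: "finite (torus p)"
  by (simp add: torus_def)

lemma card_torus: "card (torus p) = nat p * nat p"
  by (simp add: torus_def card_cartesian_product)

lemma move_in_torus: "0 < p \<Longrightarrow> move p g q \<in> torus p"
  by (cases g rule: linear_det.cases, cases q) (simp add: torus_def)

lemma move_id: "q \<in> torus p \<Longrightarrow> move p id_affine q = q"
  by (cases q) (simp add: torus_def id_affine_def)

lemma linear_mod: "(a * (s mod p) + b * (t mod p) + u) mod p = (a * s + b * t + u) mod p" for p :: int
proof -
  have "(a * (s mod p) + b * (t mod p) + u) - (a * s + b * t + u)
      = - (a * (s - s mod p)) - b * (t - t mod p)"
    by (simp only: right_diff_distrib)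
  also have "p dvd \<dots>"
    by (rule dvd_diff) simp_all
  finally show ?thesis by (simp only: mod_eq_dvd_iff)
qed

lemma move_compose: "move p (compose_affine g h) q = move p g (move p h q)"
  by (cases g rule: linear_det.cases, cases h rule: linear_det.cases, cases q)
     (simp only: compose_affine.simps move.simps linear_mod prod.inject,
      intro conjI arg_cong[where f = "\<lambda>z. z mod p"], simp_all only: algebra_simps)

text \<open>If the coefficient of one variable is invertible modulo \<open>p\<close>, the other variable determines the
  solution.\<close>
lemma card_solutions_le:
  assumes p: "prime p" and nz: "\<not> (p dvd a \<and> p dvd b \<and> p dvd c)"
  shows "card {(x, y) \<in> torus p. p dvd a * x + b * y + c} \<le> nat p"
proof -
  let ?S = "{(x, y) \<in> torus p. p dvd a * x + b * y + c}"
  have cancel: "x = x'" if "p dvd n * x - n * x'" "\<not> p dvd n" "x \<in> {0..<p}" "x' \<in> {0..<p}" for n x x' :: int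
  proof -
    have "p dvd n * (x - x')" using that(1) by (simp add: algebra_simps)
    with p that(2) have "p dvd x - x'" by (simp add: prime_dvd_mult_iff)
    then show ?thesis using that(3,4) by (auto simp: mod_eq_dvd_iff[symmetric])
  qed
  consider "\<not> p dvd a" | "\<not> p dvd b" | "p dvd a" "p dvd b" "\<not> p dvd c" using nz by blast
  then show ?thesis
  proof cases
    case 1
    have "inj_on snd ?S"
    proof (rule inj_onI, clarsimp)
      fix x y x' assume *: "(x, y) \<in> torus p" "(x', y) \<in> torus p"
        "p dvd a * x + b * y + c" "p dvd a * x' + b * y + c"
      from dvd_diff[OF *(3,4)] have "p dvd a * x - a * x'" by simp
      from cancel[OF this 1] * show "x = x'" by (simp add: torus_def)
    qed
    moreover have "snd ` ?S \<subseteq> {0..<p}" by (auto simp: torus_def)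
    ultimately show ?thesis using card_inj_on_le[of snd ?S "{0..<p}"] by simp
  next
    case 2
    have "inj_on fst ?S"
    proof (rule inj_onI, clarsimp)
      fix x y y' assume *: "(x, y) \<in> torus p" "(x, y') \<in> torus p"
        "p dvd a * x + b * y + c" "p dvd a * x + b * y' + c"
      from dvd_diff[OF *(3,4)] have "p dvd b * y - b * y'" by simp
      from cancel[OF this 2] * show "y = y'" by (simp add: torus_def)
    qed
    moreover have "fst ` ?S \<subseteq> {0..<p}" by (auto simp: torus_def)
    ultimately show ?thesis using card_inj_on_le[of fst ?S "{0..<p}"] by simp
  next
    case 3
    then have "?S = {}" by (auto simp: dvd_add_right_iff)
    then show ?thesis by (metis card.empty le0)
  qed
qed

text \<open>A fixed point solves one linear equation for each coordinate. The coefficients of the two equations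
  are not all zero, and a nonzero number of absolute value less than \<open>p\<close> is not divisible by \<open>p\<close>; so
  one of the equations is nontrivial modulo \<open>p\<close>.\<close>
lemma card_fixed_points_le:
  assumes p: "prime p" and g: "g \<noteq> id_affine"
    and large: "case g of (a, b, c, d, u, v) \<Rightarrow> \<forall>n\<in>{a - 1, b, c, d - 1, u, v}. \<bar>n\<bar> < p"
  shows "card {q \<in> torus p. move p g q = q} \<le> nat p"
proof -
  obtain a b c d u v where g_eq [simp]: "g = (a, b, c, d, u, v)" by (cases g rule: linear_det.cases)
  have nd: "n = 0" if "p dvd n" "n \<in> {a - 1, b, c, d - 1, u, v}" for n
  proof -
    have "\<bar>n\<bar> < p" using that(2) large unfolding g_eq prod.case by blast
    then show ?thesis using that(1) zdvd_not_zless[of "\<bar>n\<bar>" p] by (cases "n = 0") auto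
  qed
  have fixed: "p dvd (a - 1) * x + b * y + u" "p dvd c * x + (d - 1) * y + v"
    if "(x, y) \<in> torus p" "move p g (x, y) = (x, y)" for x y
  proof -
    have "(a * x + b * y + u) mod p = x mod p" "(c * x + d * y + v) mod p = y mod p"
      using that by (simp_all add: torus_def)
    then have "p dvd (a * x + b * y + u) - x" "p dvd (c * x + d * y + v) - y"
      by (simp_all only: mod_eq_dvd_iff)
    then show "p dvd (a - 1) * x + b * y + u" "p dvd c * x + (d - 1) * y + v"
      by (simp_all add: algebra_simps)
  qed
  have fin: "finite {(x, y) \<in> torus p. P x y}" for P
    by (rule finite_subset[OF _ finite_torus[of p]]) auto
  have "a - 1 \<noteq> 0 \<or> b \<noteq> 0 \<or> u \<noteq> 0 \<or> c \<noteq> 0 \<or> d - 1 \<noteq> 0 \<or> v \<noteq> 0"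
    using g by (auto simp: id_affine_def)
  then consider "\<not> (p dvd a - 1 \<and> p dvd b \<and> p dvd u)" | "\<not> (p dvd c \<and> p dvd d - 1 \<and> p dvd v)"
    using nd by blast
  then show ?thesis
  proof cases
    case 1
    have "{q \<in> torus p. move p g q = q} \<subseteq> {(x, y) \<in> torus p. p dvd (a - 1) * x + b * y + u}"
      using fixed by auto
    from card_mono[OF fin this] card_solutions_le[OF p 1] show ?thesis by (rule order_trans)
  next
    case 2
    have "{q \<in> torus p. move p g q = q} \<subseteq> {(x, y) \<in> torus p. p dvd c * x + (d - 1) * y + v}"
      using fixed by auto
    from card_mono[OF fin this] card_solutions_le[OF p 2] show ?thesis by (rule order_trans)
  qed
qed

section \<open>Sign functions that almost follow the determinant do not exist\<close>

text \<open>The two unit translations, the elementary shears with their inverses, and a reflection. The reflection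
  is the only one of determinant \<open>-1\<close>.\<close>
definition test_elements :: "affine set" where
  "test_elements = {(1, 0, 0, 1, 1, 0), (1, 0, 0, 1, 0, 1), (1, 1, 0, 1, 0, 0), (1, -1, 0, 1, 0, 0),
     (1, 0, 1, 1, 0, 0), (1, 0, -1, 1, 0, 0), (1, 0, 0, -1, 0, 0)}"

lemma energy_torus: "energy p h = (\<Sum>(x, y)\<in>torus p. (norm (h x y))\<^sup>2)"
  unfolding energy_def torus_def by (subst sum.swap) (simp add: sum.cartesian_product)

text \<open>A sign function differs from its translate or shear by \<open>2\<close> at each mismatch, so a proportion
  \<open>1 / 4000\<close> of mismatches gives the squared distance \<open>1 / 1000\<close> required by the spectral gap.
  The gap makes the sum at least \<open>p\<^sup>2 / \<surd>2\<close> in absolute value, while the reflection makes twice the sum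
  at most \<open>p\<^sup>2 / 2000\<close>.\<close>
lemma no_almost_equivariant_sign:
  fixes f :: "int \<times> int \<Rightarrow> real"
  assumes k: "0 \<le> k" and p: "p = 2 * k + 1"
    and sign: "\<And>q. q \<in> torus p \<Longrightarrow> f q = 1 \<or> f q = -1"
    and few: "\<And>g. g \<in> test_elements \<Longrightarrow>
      real (card {q \<in> torus p. f (move p g q) \<noteq> of_int (linear_det g) * f q}) \<le> (of_int p)\<^sup>2 / 4000"
  shows False
proof -
  have p0: "0 < p" using k p by simp
  define \<phi> where "\<phi> x y = complex_of_real (f (x mod p, y mod p))" for x y
  have per: "\<phi> (x mod p) y = \<phi> x y" "\<phi> x (y mod p) = \<phi> x y" for x y
    by (simp_all add: \<phi>_def)
  have \<phi>_torus: "\<phi> x y = f (x, y)" if "(x, y) \<in> torus p" for x y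
    using that by (simp add: \<phi>_def torus_def)
  have card_real: "real (card (torus p)) = (of_int p)\<^sup>2"
    using p0 by (simp add: card_torus power2_eq_square)
  have "energy p \<phi> = (\<Sum>q\<in>torus p. 1)"
    unfolding energy_torus by (intro sum.cong refl) (use sign in \<open>force simp: \<phi>_torus\<close>)
  then have E: "energy p \<phi> = (of_int p)\<^sup>2" using card_real by simp
  have diff: "(\<Sum>q\<in>torus p. \<bar>f (move p g q) - of_int (linear_det g) * f q\<bar> ^ n) \<le> 2 ^ n * ((of_int p)\<^sup>2 / 4000)"
    if g: "g \<in> test_elements" and n: "0 < n" for g n
  proof -
    let ?D = "{q \<in> torus p. f (move p g q) \<noteq> of_int (linear_det g) * f q}"
    have "linear_det g = 1 \<or> linear_det g = -1" using g by (auto simp: test_elements_def)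
    then have "\<bar>f (move p g q) - of_int (linear_det g) * f q\<bar> ^ n = (if q \<in> ?D then 2 ^ n else 0)" if "q \<in> torus p" for q
      using sign[OF that] sign[OF move_in_torus[OF p0, of g q]] that n by auto
    then have "(\<Sum>q\<in>torus p. \<bar>f (move p g q) - of_int (linear_det g) * f q\<bar> ^ n) = (\<Sum>q\<in>torus p. if q \<in> ?D then 2 ^ n else 0)"
      by (intro sum.cong refl) auto
    also have "\<dots> = 2 ^ n * real (card ?D)"
      by (subst sum.inter_restrict[symmetric]) (auto intro!: arg_cong[where f = card])
    also have "\<dots> \<le> 2 ^ n * ((of_int p)\<^sup>2 / 4000)"
      using few[OF g] by (intro mult_left_mono) auto
    finally show ?thesis .
  qed
  have inv: "energy p (\<lambda>x y. \<phi> (X x y) (Y x y) - \<phi> x y) \<le> energy p \<phi> / 1000"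
    if "g \<in> test_elements" "linear_det g = 1" "\<And>x y. move p g (x, y) = (X x y mod p, Y x y mod p)" for g X Y
  proof -
    have "energy p (\<lambda>x y. \<phi> (X x y) (Y x y) - \<phi> x y) = (\<Sum>q\<in>torus p. \<bar>f (move p g q) - of_int (linear_det g) * f q\<bar> ^ 2)"
      unfolding energy_torus
    proof (intro sum.cong refl, clarify)
      fix x y assume q: "(x, y) \<in> torus p"
      have "\<phi> (X x y) (Y x y) - \<phi> x y = complex_of_real (f (move p g (x, y)) - of_int (linear_det g) * f (x, y))"
        using that(2,3) q by (simp add: \<phi>_torus) (simp add: \<phi>_def)
      then show "(norm (\<phi> (X x y) (Y x y) - \<phi> x y))\<^sup>2 = \<bar>f (move p g (x, y)) - of_int (linear_det g) * f (x, y)\<bar>\<^sup>2"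
        by (simp only: norm_of_real)
    qed
    also have "\<dots> \<le> energy p \<phi> / 1000" using diff[OF that(1), of 2] by (simp add: E)
    finally show ?thesis .
  qed
  have "(of_int p)\<^sup>2 * energy p \<phi> / 2 \<le> (norm (\<Sum>y\<in>{0..<p}. \<Sum>x\<in>{0..<p}. \<phi> x y))\<^sup>2"
  proof (rule almost_invariant_imp_large_sum[where \<phi> = \<phi>, OF k p per])
    show "energy p (\<lambda>x y. \<phi> (x + 1) y - \<phi> x y) \<le> energy p \<phi> / 1000"
      by (rule inv[of "(1, 0, 0, 1, 1, 0)"]) (simp_all add: test_elements_def)
    show "energy p (\<lambda>x y. \<phi> x (y + 1) - \<phi> x y) \<le> energy p \<phi> / 1000"
      by (rule inv[of "(1, 0, 0, 1, 0, 1)"]) (simp_all add: test_elements_def)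
    show "energy p (\<lambda>x y. \<phi> (x + c * y) y - \<phi> x y) \<le> energy p \<phi> / 1000" if "c \<in> {1, -1}" for c
      by (rule inv[of "(1, c, 0, 1, 0, 0)"]) (use that in \<open>auto simp: test_elements_def\<close>)
    show "energy p (\<lambda>x y. \<phi> x (y + c * x) - \<phi> x y) \<le> energy p \<phi> / 1000" if "c \<in> {1, -1}" for c
      by (rule inv[of "(1, 0, c, 1, 0, 0)"]) (use that in \<open>auto simp: test_elements_def add.commute\<close>)
  qed
  also have "(\<Sum>y\<in>{0..<p}. \<Sum>x\<in>{0..<p}. \<phi> x y) = complex_of_real (\<Sum>q\<in>torus p. f q)"
  proof -
    have "(\<Sum>y\<in>{0..<p}. \<Sum>x\<in>{0..<p}. \<phi> x y) = (\<Sum>(x, y)\<in>torus p. \<phi> x y)"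
      unfolding torus_def by (subst sum.swap) (simp add: sum.cartesian_product)
    also have "\<dots> = (\<Sum>q\<in>torus p. complex_of_real (f q))"
      by (intro sum.cong refl) (auto simp: \<phi>_torus)
    finally show ?thesis by simp
  qed
  finally have large: "(of_int p)\<^sup>2 * (of_int p)\<^sup>2 / 2 \<le> (\<Sum>q\<in>torus p. f q)\<^sup>2"
    by (simp only: E norm_of_real power2_abs)
  let ?r = "(1, 0, 0, -1, 0, 0) :: affine"
  (* The reflection permutes the torus, so it preserves the sum, yet almost negates each term. *)
  have invol: "move p ?r (move p ?r q) = q" if "q \<in> torus p" for q
    using that move_id[of q p] by (simp add: move_compose[symmetric] id_affine_def)
  have "(\<Sum>q\<in>torus p. f q) = (\<Sum>q\<in>torus p. f (move p ?r q))"
    by (rule sum.reindex_bij_witness[where i = "move p ?r" and j = "move p ?r"])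
       (simp_all only: invol move_in_torus[OF p0])
  then have twice: "2 * (\<Sum>q\<in>torus p. f q) = (\<Sum>q\<in>torus p. f (move p ?r q) - of_int (linear_det ?r) * f q)"
    by (simp add: sum.distrib)
  have r: "?r \<in> test_elements" by (simp add: test_elements_def)
  have "\<bar>2 * (\<Sum>q\<in>torus p. f q)\<bar> \<le> (\<Sum>q\<in>torus p. \<bar>f (move p ?r q) - of_int (linear_det ?r) * f q\<bar>)"
    unfolding twice by (rule sum_abs)
  also have "\<dots> \<le> 2 * ((of_int p)\<^sup>2 / 4000)"
    using diff[OF r zero_less_one] unfolding power_one_right .
  finally have "\<bar>\<Sum>q\<in>torus p. f q\<bar> \<le> (of_int p)\<^sup>2 / 4000" by linarith
  from power_mono[OF this abs_ge_zero, of 2]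
  have "(\<Sum>q\<in>torus p. f q)\<^sup>2 \<le> (of_int p)\<^sup>2 * (of_int p)\<^sup>2 / 16000000"
    unfolding power2_abs by (simp add: power2_eq_square)
  moreover have "0 < (of_int p)\<^sup>2 * (of_int p :: real)\<^sup>2" using p0 by simp
  ultimately show False using large by linarith
qed

section \<open>Two sofic approximations\<close>

text \<open>Points of a countable type are coded by natural numbers; the transported map is the identity off the
  codes of \<open>W\<close>, as is required of a permutation of that set.\<close>
definition on_codes :: "'w::countable set \<Rightarrow> ('w \<Rightarrow> 'w) \<Rightarrow> nat \<Rightarrow> nat" where
  "on_codes W f n = (if n \<in> to_nat ` W then to_nat (f (from_nat n)) else n)"

lemma on_codes_to_nat [simp]: "on_codes W f (to_nat w) = (if w \<in> W then to_nat (f w) else to_nat w)"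
  by (auto simp: on_codes_def)

lemma card_codes: "card {n \<in> to_nat ` W. P n} = card {w \<in> W. P (to_nat w)}"
proof -
  have "{n \<in> to_nat ` W. P n} = to_nat ` {w \<in> W. P (to_nat w)}" by auto
  then show ?thesis by (simp only: card_image[OF inj_on_subset[OF inj_to_nat subset_UNIV]])
qed

text \<open>For genuine actions the multiplicativity condition holds at every point, so only asymptotic freeness
  and growth have to be supplied.\<close>
lemma sofic_approximation_of_actions:
  fixes W :: "nat \<Rightarrow> 'w::countable set" and \<alpha> :: "nat \<Rightarrow> 'g \<Rightarrow> 'w \<Rightarrow> 'w"
  assumes G: "group G" and fin: "\<And>i. finite (W i)"
    and closed: "\<And>i g w. g \<in> carrier G \<Longrightarrow> w \<in> W i \<Longrightarrow> \<alpha> i g w \<in> W i"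
    and one: "\<And>i w. w \<in> W i \<Longrightarrow> \<alpha> i \<one>\<^bsub>G\<^esub> w = w"
    and mult: "\<And>i g h w. g \<in> carrier G \<Longrightarrow> h \<in> carrier G \<Longrightarrow> w \<in> W i \<Longrightarrow>
      \<alpha> i (g \<otimes>\<^bsub>G\<^esub> h) w = \<alpha> i g (\<alpha> i h w)"
    and large: "filterlim (\<lambda>i. card (W i)) at_top sequentially"
    and free: "\<And>g. g \<in> carrier G \<Longrightarrow> g \<noteq> \<one>\<^bsub>G\<^esub> \<Longrightarrow>
      (\<lambda>i. real (card {w \<in> W i. \<alpha> i g w = w}) / real (card (W i))) \<longlonglongrightarrow> 0"
  shows "sofic_approximation G (\<lambda>i. to_nat ` W i) (\<lambda>i g. on_codes (W i) (\<alpha> i g))"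
  unfolding sofic_approximation_def
proof (intro conjI allI ballI impI)
  interpret group G by (rule G)
  have card: "card (to_nat ` W i) = card (W i)" for i
    by (rule card_image) (rule inj_on_subset[OF inj_to_nat subset_UNIV])
  show "finite (to_nat ` W i)" for i using fin by simp
  show "filterlim (\<lambda>i. card (to_nat ` W i)) at_top sequentially" using large by (simp only: card)
  show "on_codes (W i) (\<alpha> i g) permutes to_nat ` W i" if g: "g \<in> carrier G" for i g
  proof (rule bij_imp_permutes)
    have "bij_betw (\<alpha> i g) (W i) (W i)"
    proof (rule bij_betw_byWitness[where f' = "\<alpha> i (inv\<^bsub>G\<^esub> g)"])
      show "\<forall>w\<in>W i. \<alpha> i (inv\<^bsub>G\<^esub> g) (\<alpha> i g w) = w" "\<forall>w\<in>W i. \<alpha> i g (\<alpha> i (inv\<^bsub>G\<^esub> g) w) = w"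
        using g one by (simp_all add: mult[symmetric])
    qed (use g closed in auto)
    then have "inj_on (\<alpha> i g) (W i)" "\<alpha> i g ` W i = W i" by (auto simp: bij_betw_def)
    then show "bij_betw (on_codes (W i) (\<alpha> i g)) (to_nat ` W i) (to_nat ` W i)"
      unfolding bij_betw_def by (force simp: inj_on_def image_iff)
  qed (auto simp: on_codes_def)
  show "(\<lambda>i. real (card {n \<in> to_nat ` W i. on_codes (W i) (\<alpha> i g) (on_codes (W i) (\<alpha> i h) n)
      = on_codes (W i) (\<alpha> i (g \<otimes>\<^bsub>G\<^esub> h)) n}) / real (card (to_nat ` W i))) \<longlonglongrightarrow> 1"
    if gh: "g \<in> carrier G" "h \<in> carrier G" for g h
  proof (rule tendsto_eventually)
    have "eventually (\<lambda>i. 1 \<le> card (W i)) sequentially"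
      using large by (rule filterlim_at_top[THEN iffD1, rule_format])
    then show "eventually (\<lambda>i. real (card {n \<in> to_nat ` W i. on_codes (W i) (\<alpha> i g) (on_codes (W i) (\<alpha> i h) n)
      = on_codes (W i) (\<alpha> i (g \<otimes>\<^bsub>G\<^esub> h)) n}) / real (card (to_nat ` W i)) = 1) sequentially"
    proof eventually_elim
      case (elim i)
      have "{w \<in> W i. on_codes (W i) (\<alpha> i g) (on_codes (W i) (\<alpha> i h) (to_nat w))
        = on_codes (W i) (\<alpha> i (g \<otimes>\<^bsub>G\<^esub> h)) (to_nat w)} = W i"
        using gh closed by (auto simp: mult)
      then show ?case using elim by (simp add: card_codes card)
    qed
  qed
  show "(\<lambda>i. real (card {n \<in> to_nat ` W i. on_codes (W i) (\<alpha> i g) n = n}) / real (card (to_nat ` W i))) \<longlonglongrightarrow> 0"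
    if "g \<in> carrier G" "g \<noteq> \<one>\<^bsub>G\<^esub>" for g
  proof -
    have "{w \<in> W i. on_codes (W i) (\<alpha> i g) (to_nat w) = to_nat w} = {w \<in> W i. \<alpha> i g w = w}" for i
      by auto
    then show ?thesis using free[OF that] by (simp add: card_codes card)
  qed
qed

text \<open>The summand \<open>2\<close> makes the prime odd, hence of the form \<open>2 * k + 1\<close>.\<close>
definition large_prime :: "nat \<Rightarrow> int" where
  "large_prime i = (SOME p. prime p \<and> int i + 2 < p)"

lemma large_prime: "prime (large_prime i)" "int i + 2 < large_prime i"
proof -
  obtain q :: nat where "prime q" "i + 2 < q" using bigger_prime by blast
  then have "prime (int q) \<and> int i + 2 < int q" by simp
  then show "prime (large_prime i)" "int i + 2 < large_prime i"
    unfolding large_prime_def by (metis (mono_tags, lifting) someI_ex)+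
qed

text \<open>The flag \<open>t\<close> selects the approximation: \<open>False\<close> is the torus itself, written as a cover with a single
  sheet, and \<open>True\<close> is the double cover whose sheets are exchanged by elements of determinant \<open>-1\<close>.\<close>
definition sheets :: "bool \<Rightarrow> int set" where
  "sheets t = (if t then {1, -1} else {1})"

definition cover :: "int \<Rightarrow> bool \<Rightarrow> ((int \<times> int) \<times> int) set" where
  "cover p t = torus p \<times> sheets t"

definition cover_act :: "int \<Rightarrow> bool \<Rightarrow> affine \<Rightarrow> (int \<times> int) \<times> int \<Rightarrow> (int \<times> int) \<times> int" where
  "cover_act p t g w = (move p g (fst w), (if t then linear_det g else 1) * snd w)"

definition model_set :: "bool \<Rightarrow> nat \<Rightarrow> nat set" where
  "model_set t i = to_nat ` cover (large_prime i) t"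

definition model_act :: "bool \<Rightarrow> nat \<Rightarrow> nat \<Rightarrow> nat \<Rightarrow> nat" where
  "model_act t i n = on_codes (cover (large_prime i) t) (cover_act (large_prime i) t (from_nat n))"

lemma finite_cover [simp]: "finite (cover p t)"
  by (simp add: cover_def sheets_def)

lemma card_cover: "card (cover p t) = nat p * nat p * card (sheets t)"
  by (simp add: cover_def card_cartesian_product card_torus)

lemma card_sheets_pos: "0 < card (sheets t)"
  by (simp add: sheets_def)

lemma cover_act_closed:
  assumes "0 < p" "\<bar>linear_det g\<bar> = 1" "w \<in> cover p t" shows "cover_act p t g w \<in> cover p t"
proof -
  have "linear_det g = 1 \<or> linear_det g = -1" using assms(2) by linarith
  then show ?thesis
    using assms(3) move_in_torus[OF assms(1)]
    by (auto simp: cover_def cover_act_def sheets_def simp del: linear_det.simps move.simps)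
qed

text \<open>A fixed point of the cover lies above a fixed point of the torus, so the proportion of fixed points is
  at most \<open>1 / p\<close> once \<open>p\<close> exceeds the absolute values of all entries of the translation part and of
  the linear part minus the identity.\<close>
lemma sofic_approximation_model: "sofic_approximation affine_group (model_set t) (model_act t)"
  unfolding model_set_def[abs_def] model_act_def[abs_def]
proof (rule sofic_approximation_of_actions)
  have p0: "0 < large_prime i" for i using large_prime(2)[of i] by linarith
  have card_ge: "i \<le> card (cover (large_prime i) t)" for i
  proof -
    have "i \<le> nat (large_prime i)" using large_prime(2)[of i] by linarith
    also have "\<dots> \<le> card (cover (large_prime i) t)"
      using card_sheets_pos[of t] p0[of i] by (simp add: card_cover)
    finally show ?thesis .
  qed
  show "filterlim (\<lambda>i. card (cover (large_prime i) t)) at_top sequentially"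
    by (rule filterlim_at_top_mono[OF filterlim_ident]) (use card_ge in simp)
  show "cover_act (large_prime i) t (from_nat n) w \<in> cover (large_prime i) t"
    if "n \<in> carrier affine_group" "w \<in> cover (large_prime i) t" for i n w
    using that(1) by (rule affine_group_elemE) (simp add: cover_act_closed[OF p0 _ that(2)])
  show "cover_act (large_prime i) t (from_nat \<one>\<^bsub>affine_group\<^esub>) w = w"
    if "w \<in> cover (large_prime i) t" for i w
    using that by (cases w) (auto simp: cover_act_def cover_def move_id simp del: move.simps)
  show "cover_act (large_prime i) t (from_nat (m \<otimes>\<^bsub>affine_group\<^esub> n)) w
      = cover_act (large_prime i) t (from_nat m) (cover_act (large_prime i) t (from_nat n) w)"
    if "m \<in> carrier affine_group" "n \<in> carrier affine_group" for i m n w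
    using that
    by (elim affine_group_elemE)
       (simp add: cover_act_def move_compose det_compose mult.assoc del: move.simps linear_det.simps)
  show "(\<lambda>i. real (card {w \<in> cover (large_prime i) t. cover_act (large_prime i) t (from_nat n) w = w})
      / real (card (cover (large_prime i) t))) \<longlonglongrightarrow> 0"
    if n: "n \<in> carrier affine_group" "n \<noteq> \<one>\<^bsub>affine_group\<^esub>" for n
  proof -
    from n(1) obtain g where g: "n = to_nat g" "\<bar>linear_det g\<bar> = 1" by (rule affine_group_elemE)
    have ne: "g \<noteq> id_affine" using n(2) g(1) by simp
    obtain a b c d u v where gs: "g = (a, b, c, d, u, v)" by (cases g rule: linear_det.cases)
    define N where "N = nat (Max (abs ` {a - 1, b, c, d - 1, u, v}))"
    have bound: "real (card {w \<in> cover (large_prime i) t. cover_act (large_prime i) t g w = w})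
        / real (card (cover (large_prime i) t)) \<le> inverse (real (Suc i))" if "N \<le> i" for i
    proof -
      let ?p = "large_prime i"
      have large: "case g of (a, b, c, d, u, v) \<Rightarrow> \<forall>n\<in>{a - 1, b, c, d - 1, u, v}. \<bar>n\<bar> < ?p"
      proof -
        have "\<bar>n\<bar> < ?p" if "n \<in> {a - 1, b, c, d - 1, u, v}" for n
        proof -
          have "\<bar>n\<bar> \<le> Max (abs ` {a - 1, b, c, d - 1, u, v})" using that by (intro Max_ge) auto
          then show ?thesis using \<open>N \<le> i\<close> large_prime(2)[of i] unfolding N_def by linarith
        qed
        then show ?thesis unfolding gs prod.case by blast
      qed
      have "{w \<in> cover ?p t. cover_act ?p t g w = w} \<subseteq> {q \<in> torus ?p. move ?p g q = q} \<times> sheets t"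
        by (auto simp: cover_def cover_act_def simp del: move.simps)
      then have "card {w \<in> cover ?p t. cover_act ?p t g w = w} \<le> card ({q \<in> torus ?p. move ?p g q = q} \<times> sheets t)"
        by (rule card_mono[rotated]) (simp add: sheets_def)
      also have "\<dots> \<le> nat ?p * card (sheets t)"
        unfolding card_cartesian_product
        by (rule mult_right_mono[OF card_fixed_points_le[OF large_prime(1) ne large]]) simp
      finally have "real (card {w \<in> cover ?p t. cover_act ?p t g w = w}) / real (card (cover ?p t))
          \<le> real (nat ?p * card (sheets t)) / real (card (cover ?p t))"
        by (intro divide_right_mono) (simp_all only: of_nat_le_iff of_nat_0_le_iff)
      also have "\<dots> = inverse (real (nat ?p))"
        using card_sheets_pos[of t] p0[of i] by (simp add: card_cover divide_simps)
      also have "\<dots> \<le> inverse (real (Suc i))"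
        using large_prime(2)[of i] by (intro le_imp_inverse_le) auto
      finally show ?thesis .
    qed
    show ?thesis
    proof (rule tendsto_sandwich[OF _ _ tendsto_const LIMSEQ_inverse_real_of_nat])
      show "\<forall>\<^sub>F i in sequentially. real (card {w \<in> cover (large_prime i) t. cover_act (large_prime i) t (from_nat n) w = w})
        / real (card (cover (large_prime i) t)) \<le> inverse (real (Suc i))"
        using eventually_ge_at_top[of N] by eventually_elim (simp only: g(1) from_nat_to_nat bound)
    qed simp
  qed
qed (simp_all add: group_affine_group)

section \<open>Criteria for the value of sofic entropy\<close>

lemma sep_number_empty [simp]: "sep_number \<rho> V \<epsilon> {} = 0"
proof -
  have "{card A |A. A \<subseteq> {} \<and> finite A \<and> (\<forall>x\<in>A. \<forall>y\<in>A. x \<noteq> y \<longrightarrow> rho_inf \<rho> V x y \<ge> \<epsilon>)} = {0}"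
    by auto
  then show ?thesis by (simp only: sep_number_def Max_singleton)
qed

lemma sep_number_pos:
  assumes "finite S" "x \<in> S"
  shows "0 < sep_number \<rho> V \<epsilon> S"
proof -
  let ?N = "{card A |A. A \<subseteq> S \<and> finite A \<and> (\<forall>x\<in>A. \<forall>y\<in>A. x \<noteq> y \<longrightarrow> rho_inf \<rho> V x y \<ge> \<epsilon>)}"
  have "?N \<subseteq> card ` Pow S" by auto
  then have "finite ?N" by (rule finite_subset) (simp add: assms(1))
  moreover have "card {x} \<in> ?N" using assms(2) by (intro CollectI exI[of _ "{x}"]) auto
  ultimately have "card {x} \<le> Max ?N" by (rule Max_ge)
  then show ?thesis by (simp add: sep_number_def)
qed

lemma limsup_rate_no_models:
  assumes "eventually (\<lambda>i. S i = {}) sequentially"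
    and "filterlim (\<lambda>i. card (V i)) at_top sequentially"
  shows "limsup (\<lambda>i. log_nat (sep_number \<rho> (V i) \<epsilon> (S i)) / ereal (real (card (V i)))) = - \<infinity>"
proof -
  have "eventually (\<lambda>i. 1 \<le> card (V i)) sequentially"
    using assms(2) by (rule filterlim_at_top[THEN iffD1, rule_format])
  with assms(1) have "eventually (\<lambda>i. log_nat (sep_number \<rho> (V i) \<epsilon> (S i)) / ereal (real (card (V i))) \<le> - \<infinity>) sequentially"
    by eventually_elim (simp add: log_nat_def divide_ereal_def)
  from Limsup_bounded[OF this] show ?thesis by simp
qed

lemma limsup_rate_nonneg:
  assumes "\<And>i. finite (S i)" "\<And>i. S i \<noteq> {}"
  shows "0 \<le> limsup (\<lambda>i. log_nat (sep_number \<rho> (V i) \<epsilon> (S i)) / ereal (real (card (V i))))"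
proof (rule le_Limsup)
  show "\<forall>\<^sub>F i in sequentially. 0 \<le> log_nat (sep_number \<rho> (V i) \<epsilon> (S i)) / ereal (real (card (V i)))"
  proof (rule always_eventually, rule allI)
    fix i
    obtain x where "x \<in> S i" using assms(2) by blast
    from sep_number_pos[OF assms(1) this] have "0 < sep_number \<rho> (V i) \<epsilon> (S i)" .
    then have "0 \<le> log_nat (sep_number \<rho> (V i) \<epsilon> (S i))" by (simp add: log_nat_def)
    then show "0 \<le> log_nat (sep_number \<rho> (V i) \<epsilon> (S i)) / ereal (real (card (V i)))"
      by (simp add: divide_ereal_def inverse_ereal_ge0I)
  qed
qed simp

text \<open>A single pair \<open>F\<close>, \<open>\<delta>\<close> without models already gives exponential growth rate \<open>- \<infinity>\<close> for every \<open>\<epsilon>\<close>. For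
  measure entropy the neighbourhood may be taken to be the whole space of measures, which is open
  because it is the preimage of the real line under the integral of a constant.\<close>
lemma entropies_eq_MInf:
  assumes F: "finite F" "F \<subseteq> carrier G" and \<delta>: "0 < \<delta>"
    and empty: "eventually (\<lambda>i. Map_set X T \<rho> F \<delta> (V i) (\<sigma> i) = {}) sequentially"
    and large: "filterlim (\<lambda>i. card (V i)) at_top sequentially"
  shows "top_sofic_entropy G X T \<rho> V \<sigma> = - \<infinity>"
    and "\<mu> \<in> borel_prob_measures X \<Longrightarrow> measure_sofic_entropy G X T \<rho> \<mu> V \<sigma> = - \<infinity>"
proof -
  have "top_sofic_entropy G X T \<rho> V \<sigma> \<le> - \<infinity>"
    unfolding top_sofic_entropy_def
  proof (rule SUP_least)
    fix \<epsilon> :: real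
    show "(INF F\<in>{F. finite F \<and> F \<subseteq> carrier G}. INF \<delta>\<in>{0<..}.
        limsup (\<lambda>i. log_nat (sep_number \<rho> (V i) \<epsilon> (Map_set X T \<rho> F \<delta> (V i) (\<sigma> i)))
          / ereal (real (card (V i))))) \<le> - \<infinity>"
      by (rule INF_lower2[of F], use F in simp, rule INF_lower2[of \<delta>], use \<delta> in simp)
         (simp only: limsup_rate_no_models[OF empty large] order_refl)
  qed
  then show "top_sofic_entropy G X T \<rho> V \<sigma> = - \<infinity>" by simp
  assume \<mu>: "\<mu> \<in> borel_prob_measures X"
  have "openin (weak_star_topology X) {\<nu> \<in> borel_prob_measures X. (\<integral>x. 0 \<partial>\<nu>) \<in> (UNIV :: real set)}"
    unfolding weak_star_topology_def
    by (rule topology_generated_by_Basis, rule CollectI, rule exI[of _ "\<lambda>_. 0"], rule exI[of _ UNIV]) simp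
  then have whole: "openin (weak_star_topology X) (borel_prob_measures X)" by simp
  have "measure_sofic_entropy G X T \<rho> \<mu> V \<sigma> \<le> - \<infinity>"
    unfolding measure_sofic_entropy_def
  proof (rule SUP_least)
    fix \<epsilon> :: real
    have ev: "eventually (\<lambda>i. {x \<in> Map_set X T \<rho> F \<delta> (V i) (\<sigma> i).
        empirical_measure X (V i) x \<in> borel_prob_measures X} = {}) sequentially"
      using empty by eventually_elim simp
    show "(INF O'\<in>{O'. openin (weak_star_topology X) O' \<and> \<mu> \<in> O'}.
        INF F\<in>{F. finite F \<and> F \<subseteq> carrier G}. INF \<delta>\<in>{0<..}.
        limsup (\<lambda>i. log_nat (sep_number \<rho> (V i) \<epsilon>
          {x \<in> Map_set X T \<rho> F \<delta> (V i) (\<sigma> i). empirical_measure X (V i) x \<in> O'})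
          / ereal (real (card (V i))))) \<le> - \<infinity>"
      by (rule INF_lower2[of "borel_prob_measures X"], use whole \<mu> in simp,
          rule INF_lower2[of F], use F in simp, rule INF_lower2[of \<delta>], use \<delta> in simp)
         (simp only: limsup_rate_no_models[OF ev large] order_refl)
  qed
  then show "measure_sofic_entropy G X T \<rho> \<mu> V \<sigma> = - \<infinity>" by simp
qed

text \<open>A point in all sets of models is a separated set of one element, whose logarithm is zero.\<close>
lemma entropies_nonneg:
  assumes fin: "finite (topspace X)" "\<And>i. finite (V i)"
    and model: "\<And>i F \<delta>. F \<subseteq> carrier G \<Longrightarrow> 0 < \<delta> \<Longrightarrow> x i \<in> Map_set X T \<rho> F \<delta> (V i) (\<sigma> i)"
  shows "0 \<le> top_sofic_entropy G X T \<rho> V \<sigma>"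
    and "(\<And>i. empirical_measure X (V i) (x i) = \<mu>) \<Longrightarrow> 0 \<le> measure_sofic_entropy G X T \<rho> \<mu> V \<sigma>"
proof -
  have finM: "finite (Map_set X T \<rho> F \<delta> (V i) (\<sigma> i))" for F \<delta> i
    unfolding Map_set_def by (rule finite_subset[OF _ finite_PiE[of "V i" "\<lambda>_. topspace X"]]) (use fin in auto)
  show "0 \<le> top_sofic_entropy G X T \<rho> V \<sigma>"
    unfolding top_sofic_entropy_def
  proof (rule SUP_upper2[of 1], simp, intro INF_greatest limsup_rate_nonneg finM)
    fix F \<delta> i assume "F \<in> {F. finite F \<and> F \<subseteq> carrier G}" "\<delta> \<in> {0::real<..}"
    then have "x i \<in> Map_set X T \<rho> F \<delta> (V i) (\<sigma> i)" by (intro model) auto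
    then show "Map_set X T \<rho> F \<delta> (V i) (\<sigma> i) \<noteq> {}" by blast
  qed
  assume emp: "\<And>i. empirical_measure X (V i) (x i) = \<mu>"
  show "0 \<le> measure_sofic_entropy G X T \<rho> \<mu> V \<sigma>"
    unfolding measure_sofic_entropy_def
  proof (rule SUP_upper2[of 1], simp, intro INF_greatest limsup_rate_nonneg)
    fix O' F \<delta> i
    assume *: "O' \<in> {O'. openin (weak_star_topology X) O' \<and> \<mu> \<in> O'}"
      "F \<in> {F. finite F \<and> F \<subseteq> carrier G}" "\<delta> \<in> {0::real<..}"
    show "finite {x \<in> Map_set X T \<rho> F \<delta> (V i) (\<sigma> i). empirical_measure X (V i) x \<in> O'}"
      using finM by simp
    have "x i \<in> {x \<in> Map_set X T \<rho> F \<delta> (V i) (\<sigma> i). empirical_measure X (V i) x \<in> O'}"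
      using * model[of F \<delta> i] emp by auto
    then show "{x \<in> Map_set X T \<rho> F \<delta> (V i) (\<sigma> i). empirical_measure X (V i) x \<in> O'} \<noteq> {}"
      by blast
  qed
qed

section \<open>The two-point system\<close>

definition const_seq :: "real \<Rightarrow> nat \<Rightarrow> real" where
  "const_seq s = (\<lambda>_. s)"

definition two_points :: "(nat \<Rightarrow> real) set" where
  "two_points = {const_seq 1, const_seq (-1)}"

text \<open>Group actions are required to consist of extensional functions, hence the restriction to the two
  points.\<close>
definition sign_action :: "nat \<Rightarrow> (nat \<Rightarrow> real) \<Rightarrow> nat \<Rightarrow> real" where
  "sign_action n = (\<lambda>x\<in>two_points. \<lambda>k. of_int (linear_det (from_nat n)) * x k)"

lemma const_seq_eq_iff [simp]: "const_seq s = const_seq t \<longleftrightarrow> s = t"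
  by (simp add: const_seq_def fun_eq_iff)

lemma finite_two_points [simp]: "finite two_points"
  by (simp add: two_points_def)

lemma card_two_points: "card two_points = 2"
  by (simp add: two_points_def)

lemma two_pointsE:
  assumes "x \<in> two_points"
  obtains s where "x = const_seq s" "s = 1 \<or> s = -1"
  using assms unfolding two_points_def by auto

lemma const_seq_in_two_points [simp]: "const_seq s \<in> two_points \<longleftrightarrow> s = 1 \<or> s = -1"
  by (simp add: two_points_def)

lemma sign_action_const [simp]:
  "s = 1 \<or> s = -1 \<Longrightarrow> sign_action (to_nat g) (const_seq s) = const_seq (of_int (linear_det g) * s)"
  by (simp add: sign_action_def) (simp add: const_seq_def)

lemma unit_det_cases: "\<bar>linear_det g\<bar> = 1 \<Longrightarrow> linear_det g = 1 \<or> linear_det g = -1"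
  by linarith

lemma sign_action_compose:
  assumes "\<bar>linear_det g\<bar> = 1" "\<bar>linear_det h\<bar> = 1" "x \<in> two_points"
  shows "sign_action (to_nat g) (sign_action (to_nat h) x) = sign_action (to_nat (compose_affine g h)) x"
proof -
  obtain s where s: "x = const_seq s" "s = 1 \<or> s = -1" using assms(3) by (rule two_pointsE)
  have "of_int (linear_det h) * s = 1 \<or> of_int (linear_det h) * s = -1"
    using s(2) unit_det_cases[OF assms(2)] by auto
  then show ?thesis using s by (simp add: det_compose mult.assoc del: linear_det.simps)
qed

lemma sign_action_in:
  assumes "\<bar>linear_det g\<bar> = 1" "x \<in> two_points"
  shows "sign_action (to_nat g) x \<in> two_points"
  using assms(2)
proof (rule two_pointsE)
  fix s assume "x = const_seq s" "s = 1 \<or> s = -1"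
  then show ?thesis using unit_det_cases[OF assms(1)] by auto
qed

lemma sign_action_involution:
  assumes "\<bar>linear_det g\<bar> = 1" "x \<in> two_points"
  shows "sign_action (to_nat g) (sign_action (to_nat g) x) = x"
  using assms(2)
proof (rule two_pointsE)
  fix s assume "x = const_seq s" "s = 1 \<or> s = -1"
  then show ?thesis using unit_det_cases[OF assms(1)] by auto
qed

lemma bij_sign_action:
  assumes "\<bar>linear_det g\<bar> = 1" shows "bij_betw (sign_action (to_nat g)) two_points two_points"
  by (rule bij_betw_byWitness[where f' = "sign_action (to_nat g)"])
     (auto simp: sign_action_involution[OF assms] intro: sign_action_in[OF assms])

lemma continuous_sign_action:
  "continuous_group_action affine_group (discrete_topology two_points) sign_action"
proof -
  have Bij: "sign_action n \<in> Bij two_points" if n: "n \<in> carrier affine_group" for n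
  proof -
    from n obtain g where g: "n = to_nat g" "\<bar>linear_det g\<bar> = 1" by (rule affine_group_elemE)
    have "sign_action n \<in> extensional two_points" by (simp add: sign_action_def)
    then show ?thesis using bij_sign_action[OF g(2)] by (simp add: Bij_def g(1))
  qed
  have "group_action affine_group two_points sign_action"
    unfolding group_action_def group_hom_def group_hom_axioms_def
  proof (intro conjI group_affine_group group_BijGroup homI)
    show "sign_action n \<in> carrier (BijGroup two_points)" if "n \<in> carrier affine_group" for n
      using Bij[OF that] by (simp add: BijGroup_def)
    show "sign_action (m \<otimes>\<^bsub>affine_group\<^esub> n) = sign_action m \<otimes>\<^bsub>BijGroup two_points\<^esub> sign_action n"
      if mn: "m \<in> carrier affine_group" "n \<in> carrier affine_group" for m n
    proof -
      from mn(1) obtain g where g: "m = to_nat g" "\<bar>linear_det g\<bar> = 1" by (rule affine_group_elemE)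
      from mn(2) obtain h where h: "n = to_nat h" "\<bar>linear_det h\<bar> = 1" by (rule affine_group_elemE)
      have "sign_action (to_nat (compose_affine g h)) = compose two_points (sign_action m) (sign_action n)"
      proof
        fix x show "sign_action (to_nat (compose_affine g h)) x = compose two_points (sign_action m) (sign_action n) x"
        proof (cases "x \<in> two_points")
          case True
          then show ?thesis by (simp add: compose_def g(1) h(1) sign_action_compose[OF g(2) h(2)])
        qed (simp add: compose_def sign_action_def)
      qed
      then show ?thesis using Bij[OF mn(1)] Bij[OF mn(2)] by (simp add: BijGroup_def g(1) h(1))
    qed
  qed
  moreover have "homeomorphic_map (discrete_topology two_points) (discrete_topology two_points) (sign_action n)"
    if n: "n \<in> carrier affine_group" for n
  proof -
    from n obtain g where g: "n = to_nat g" "\<bar>linear_det g\<bar> = 1" by (rule affine_group_elemE)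
    have "homeomorphic_maps (discrete_topology two_points) (discrete_topology two_points) (sign_action n) (sign_action n)"
      unfolding homeomorphic_maps_def
      using sign_action_in[OF g(2)] sign_action_involution[OF g(2)] by (auto simp: g(1))
    then show ?thesis by (rule homeomorphic_maps_imp_map)
  qed
  ultimately show ?thesis by (simp add: continuous_group_action_def)
qed

text \<open>The pseudometric is generating and the orbit of a pair of distinct points consists of this pair and
  its transpose; so the two points have positive distance.\<close>
lemma pseudometric_two_points:
  assumes "generating_pseudometric affine_group (discrete_topology two_points) sign_action \<rho>"
  obtains r where "0 < r" "\<forall>x\<in>two_points. \<forall>y\<in>two_points. \<rho> x y = (if x = y then 0 else r)"
proof -
  let ?a = "const_seq 1" and ?b = "const_seq (-1)"
  have refl: "\<rho> x x = 0" if "x \<in> two_points" for x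
    using assms that by (simp add: generating_pseudometric_def continuous_pseudometric_def)
  have sym: "\<rho> x y = \<rho> y x" if "x \<in> two_points" "y \<in> two_points" for x y
    using assms that by (simp add: generating_pseudometric_def continuous_pseudometric_def)
  have "\<exists>n\<in>carrier affine_group. 0 < \<rho> (sign_action n ?a) (sign_action n ?b)"
    using assms by (simp add: generating_pseudometric_def)
  then obtain n where n: "n \<in> carrier affine_group" "0 < \<rho> (sign_action n ?a) (sign_action n ?b)" by blast
  from n(1) obtain g where g: "n = to_nat g" "\<bar>linear_det g\<bar> = 1" by (rule affine_group_elemE)
  have "0 < \<rho> ?a ?b"
    using n(2) unit_det_cases[OF g(2)] sym[of ?a ?b] by (auto simp: g(1))
  then show ?thesis
  proof (rule that)
    show "\<forall>x\<in>two_points. \<forall>y\<in>two_points. \<rho> x y = (if x = y then 0 else \<rho> ?a ?b)"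
      using refl sym[of ?a ?b] unfolding two_points_def by auto
  qed
qed

section \<open>Absence and presence of models\<close>

lemma test_elements_in_carrier: "to_nat ` test_elements \<subseteq> carrier affine_group"
  by (auto simp: test_elements_def)

text \<open>In an approximate model each mismatch contributes \<open>r\<^sup>2\<close> to the squared distance, so the threshold
  \<open>r / sqrt 4000\<close> bounds the proportion of mismatches by \<open>1 / 4000\<close>.\<close>
lemma no_models_on_torus:
  assumes r: "0 < r"
    and \<rho>: "\<And>x y. x \<in> two_points \<Longrightarrow> y \<in> two_points \<Longrightarrow> \<rho> x y = (if x = y then 0 else r)"
  shows "Map_set (discrete_topology two_points) sign_action \<rho> (to_nat ` test_elements) (r / sqrt 4000)
    (model_set False i) (model_act False i) = {}"
proof (rule equals0I)
  let ?p = "large_prime i"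
  fix x assume x: "x \<in> Map_set (discrete_topology two_points) sign_action \<rho> (to_nat ` test_elements) (r / sqrt 4000)
    (model_set False i) (model_act False i)"
  have p0: "0 < ?p" using large_prime(2)[of i] by linarith
  define c where "c q = to_nat (q, 1::int)" for q :: "int \<times> int"
  have V: "model_set False i = c ` torus ?p"
    by (auto simp: model_set_def cover_def sheets_def c_def)
  have inj: "inj_on c A" for A by (auto simp: c_def inj_on_def)
  have act: "model_act False i (to_nat g) (c q) = c (move ?p g q)" if "q \<in> torus ?p" for g q
    using that by (simp add: model_act_def c_def cover_def sheets_def cover_act_def del: move.simps)
  have xc: "x (c q) \<in> two_points" if "q \<in> torus ?p" for q
    using x that by (auto simp: Map_set_def V)
  define f where "f q = x (c q) 0" for q
  have f: "x (c q) = const_seq (f q)" "f q = 1 \<or> f q = -1" if "q \<in> torus ?p" for q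
    using xc[OF that] by (auto simp: f_def two_points_def const_seq_def)
  have card_V: "real (card (torus ?p)) = (of_int ?p)\<^sup>2"
    using p0 by (simp add: card_torus power2_eq_square)
  have few: "real (card {q \<in> torus ?p. f (move ?p g q) \<noteq> of_int (linear_det g) * f q}) \<le> (of_int ?p)\<^sup>2 / 4000"
    if g: "g \<in> test_elements" for g
  proof -
    let ?D = "{q \<in> torus ?p. f (move ?p g q) \<noteq> of_int (linear_det g) * f q}"
    have "to_nat g \<in> carrier affine_group" using test_elements_in_carrier g by blast
    then have detg: "linear_det g = 1 \<or> linear_det g = -1" using unit_det_cases by simp
    have term_eq: "(\<rho> (sign_action (to_nat g) (x (c q))) (x (model_act False i (to_nat g) (c q))))\<^sup>2
        = (if q \<in> ?D then r\<^sup>2 else 0)" if q: "q \<in> torus ?p" for q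
    proof -
      have fgq: "x (c (move ?p g q)) = const_seq (f (move ?p g q))" "f (move ?p g q) = 1 \<or> f (move ?p g q) = -1"
        by (rule f[OF move_in_torus[OF p0]])+
      have "of_int (linear_det g) * f q = 1 \<or> of_int (linear_det g) * f q = -1" using detg f(2)[OF q] by auto
      then have "\<rho> (const_seq (of_int (linear_det g) * f q)) (const_seq (f (move ?p g q)))
          = (if of_int (linear_det g) * f q = f (move ?p g q) then 0 else r)"
        using fgq(2) by (simp only: \<rho> const_seq_in_two_points const_seq_eq_iff)
      then show ?thesis
        unfolding act[OF q] fgq(1) f(1)[OF q] sign_action_const[OF f(2)[OF q]]
        using q by (simp del: move.simps linear_det.simps)
    qed
    have "(\<Sum>v\<in>model_set False i. (\<rho> (sign_action (to_nat g) (x v)) (x (model_act False i (to_nat g) v)))\<^sup>2)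
        = (\<Sum>q\<in>torus ?p. if q \<in> ?D then r\<^sup>2 else 0)"
      unfolding V sum.reindex[OF inj] o_def by (rule sum.cong[OF refl term_eq])
    also have "\<dots> = real (card ?D) * r\<^sup>2"
      by (subst sum.inter_restrict[symmetric]) (auto intro!: arg_cong[where f = card])
    finally have sum_eq: "(\<Sum>v\<in>model_set False i. (\<rho> (sign_action (to_nat g) (x v)) (x (model_act False i (to_nat g) v)))\<^sup>2)
        = real (card ?D) * r\<^sup>2" .
    have "rho_two \<rho> (model_set False i) (\<lambda>v. sign_action (to_nat g) (x v)) (\<lambda>v. x (model_act False i (to_nat g) v)) < r / sqrt 4000"
      using x g by (auto simp: Map_set_def)
    then have "sqrt (real (card ?D) * r\<^sup>2 / (of_int ?p)\<^sup>2) < sqrt (r\<^sup>2 / 4000)"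
      using r unfolding rho_two_def sum_eq
      by (simp add: V card_image[OF inj] card_V real_sqrt_divide)
    then have "real (card ?D) * r\<^sup>2 / (of_int ?p)\<^sup>2 < r\<^sup>2 / 4000" by (simp only: real_sqrt_less_iff)
    then have "real (card ?D) * r\<^sup>2 < (of_int ?p)\<^sup>2 / 4000 * r\<^sup>2"
      using p0 by (simp add: field_simps)
    then show ?thesis using r by (simp add: mult_less_cancel_right)
  qed
  have "odd ?p" using large_prime[of i] by (intro prime_odd_int) auto
  then obtain k where k: "?p = 2 * k + 1" by (rule oddE)
  have "0 \<le> k" using k p0 by linarith
  from no_almost_equivariant_sign[OF this k f(2) few] show False by simp
qed

definition coin :: "(nat \<Rightarrow> real) measure" where
  "coin = uniform_count_measure two_points"

lemma sets_borel_of_two_points: "sets (borel_of_top (discrete_topology two_points)) = Pow two_points"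
proof -
  have "{U. openin (discrete_topology two_points) U} = Pow two_points" by auto
  then have "sets (borel_of_top (discrete_topology two_points)) = sigma_sets two_points (Pow two_points)"
    by (simp add: borel_of_top_def sets_measure_of)
  then show ?thesis
    by (simp only: sigma_algebra.sigma_sets_eq[OF sigma_algebra_Pow])
qed

lemma space_borel_of_two_points: "space (borel_of_top (discrete_topology two_points)) = two_points"
  by (simp add: borel_of_top_def space_measure_of_conv)

lemma coin_in_borel_prob: "coin \<in> borel_prob_measures (discrete_topology two_points)"
proof -
  have "prob_space coin"
    unfolding coin_def by (rule prob_space_uniform_count_measure) (auto simp: two_points_def)
  then show ?thesis
    by (simp add: borel_prob_measures_def sets_borel_of_two_points) (simp add: coin_def sets_uniform_count_measure)
qed

text \<open>This serves twice: with \<open>V\<close> the two points it gives invariance of the uniform measure, and with \<open>V\<close> the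
  double cover it computes the empirical measure of the exact model.\<close>
lemma distr_balanced_eq_coin:
  assumes fin: "finite V" and V: "V \<noteq> {}" and x: "x \<in> V \<rightarrow> two_points"
    and bal: "\<And>s. s = 1 \<or> s = -1 \<Longrightarrow> 2 * card {v \<in> V. x v = const_seq s} = card V"
  shows "distr (uniform_count_measure V) (borel_of_top (discrete_topology two_points)) x = coin"
proof (rule measure_eqI_finite[where A = two_points])
  show "sets (distr (uniform_count_measure V) (borel_of_top (discrete_topology two_points)) x) = Pow two_points"
    by (simp add: sets_borel_of_two_points)
  show "sets coin = Pow two_points" by (simp add: coin_def sets_uniform_count_measure)
  fix a assume a: "a \<in> two_points"
  have meas: "x \<in> measurable (uniform_count_measure V) (borel_of_top (discrete_topology two_points))"
    unfolding measurable_def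
    using x by (simp add: space_uniform_count_measure sets_uniform_count_measure
        space_borel_of_two_points sets_borel_of_two_points)
  have pre: "x -` {a} \<inter> V = {v \<in> V. x v = a}" by auto
  have "2 * card {v \<in> V. x v = a} = card V"
    using a by (auto elim: two_pointsE simp: bal)
  then have "real (card V) = 2 * real (card {v \<in> V. x v = a})" by linarith
  moreover have "0 < card V" using fin V by (simp add: card_gt_0_iff)
  ultimately have half: "real (card {v \<in> V. x v = a}) / real (card V) = 1 / 2" by simp
  have "emeasure (distr (uniform_count_measure V) (borel_of_top (discrete_topology two_points)) x) {a}
      = emeasure (uniform_count_measure V) {v \<in> V. x v = a}"
    using a by (subst emeasure_distr[OF meas])
       (auto simp: sets_borel_of_two_points space_uniform_count_measure pre)
  also have "\<dots> = ennreal (1 / 2)"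
    using fin by (simp add: emeasure_uniform_count_measure half)
  also have "\<dots> = emeasure coin {a}"
    using a by (simp add: coin_def emeasure_uniform_count_measure card_two_points)
  finally show "emeasure (distr (uniform_count_measure V) (borel_of_top (discrete_topology two_points)) x) {a} = emeasure coin {a}" .
qed simp

lemma invariant_coin: "invariant_measure affine_group (discrete_topology two_points) sign_action coin"
  unfolding invariant_measure_def
proof
  fix n assume "n \<in> carrier affine_group"
  then obtain g where g: "n = to_nat g" "\<bar>linear_det g\<bar> = 1" by (rule affine_group_elemE)
  have "distr (uniform_count_measure two_points) (borel_of_top (discrete_topology two_points)) (sign_action n) = coin"
  proof (rule distr_balanced_eq_coin)
    show "sign_action n \<in> two_points \<rightarrow> two_points"
      using sign_action_in[OF g(2)] by (simp add: g(1))
    fix s :: real assume s: "s = 1 \<or> s = -1"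
    have "{v \<in> two_points. sign_action n v = const_seq s} = {const_seq (of_int (linear_det g) * s)}"
      using unit_det_cases[OF g(2)] s unfolding two_points_def by (auto simp: g(1))
    then show "2 * card {v \<in> two_points. sign_action n v = const_seq s} = card two_points"
      by (simp add: card_two_points)
  qed (auto simp: two_points_def)
  then show "distr coin (borel_of_top (discrete_topology two_points)) (sign_action n) = coin"
    by (simp only: coin_def)
qed

text \<open>The exact model on the double cover: each vertex is sent to the point named by its sheet.\<close>
definition sheet_model :: "nat \<Rightarrow> nat \<Rightarrow> nat \<Rightarrow> real" where
  "sheet_model i = (\<lambda>v\<in>model_set True i. const_seq (of_int (snd (from_nat v :: (int \<times> int) \<times> int))))"

lemma sheet_model_code:
  "w \<in> cover (large_prime i) True \<Longrightarrow> sheet_model i (to_nat w) = const_seq (of_int (snd w))"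
  by (simp add: sheet_model_def model_set_def)

lemma snd_cover: "w \<in> cover p True \<Longrightarrow> snd w = 1 \<or> snd w = -1"
  by (auto simp: cover_def sheets_def)

lemma sheet_model_in_two_points:
  assumes "v \<in> model_set True i" shows "sheet_model i v \<in> two_points"
proof -
  obtain w where w: "v = to_nat w" "w \<in> cover (large_prime i) True"
    using assms by (auto simp: model_set_def)
  then show ?thesis using snd_cover[OF w(2)] by (auto simp: sheet_model_code)
qed

lemma sheet_model_in_Map_set:
  assumes r: "0 < r"
    and \<rho>: "\<And>x y. x \<in> two_points \<Longrightarrow> y \<in> two_points \<Longrightarrow> \<rho> x y = (if x = y then 0 else r)"
    and F: "F \<subseteq> carrier affine_group" and \<delta>: "0 < \<delta>"
  shows "sheet_model i \<in> Map_set (discrete_topology two_points) sign_action \<rho> F \<delta> (model_set True i) (model_act True i)"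
proof -
  let ?p = "large_prime i"
  have p0: "0 < ?p" using large_prime(2)[of i] by linarith
  have zero: "\<rho> (sign_action n (sheet_model i v)) (sheet_model i (model_act True i n v)) = 0"
    if n: "n \<in> F" and v: "v \<in> model_set True i" for n v
  proof -
    from n F have "n \<in> carrier affine_group" by blast
    then obtain g where g: "n = to_nat g" "\<bar>linear_det g\<bar> = 1" by (rule affine_group_elemE)
    obtain w where w: "v = to_nat w" "w \<in> cover ?p True" using v by (auto simp: model_set_def)
    have gw: "cover_act ?p True g w \<in> cover ?p True" by (rule cover_act_closed[OF p0 g(2) w(2)])
    have "sheet_model i (model_act True i n v) = const_seq (of_int (linear_det g) * of_int (snd w))"
      using w gw by (simp add: model_act_def g(1) sheet_model_code del: linear_det.simps)
        (simp add: cover_act_def)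
    moreover have "sign_action n (sheet_model i v) = const_seq (of_int (linear_det g) * of_int (snd w))"
      using snd_cover[OF w(2)] w by (simp only: w(1) g(1) sheet_model_code) auto
    moreover have "const_seq (of_int (linear_det g) * of_int (snd w)) \<in> two_points"
      using snd_cover[OF w(2)] unit_det_cases[OF g(2)] by auto
    ultimately show ?thesis by (simp only: \<rho> simp_thms if_True)
  qed
  show ?thesis
    unfolding Map_set_def
  proof (intro CollectI conjI ballI)
    show "sheet_model i \<in> model_set True i \<rightarrow>\<^sub>E topspace (discrete_topology two_points)"
      using sheet_model_in_two_points by (auto simp: PiE_def) (simp add: sheet_model_def)
    fix n assume n: "n \<in> F"
    have "rho_two \<rho> (model_set True i) (\<lambda>v. sign_action n (sheet_model i v)) (\<lambda>v. sheet_model i (model_act True i n v)) = 0"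
      unfolding rho_two_def by (simp add: zero[OF n])
    then show "rho_two \<rho> (model_set True i) (\<lambda>v. sign_action n (sheet_model i v)) (\<lambda>v. sheet_model i (model_act True i n v)) < \<delta>"
      using \<delta> by simp
  qed
qed

lemma empirical_sheet_model:
  "empirical_measure (discrete_topology two_points) (model_set True i) (sheet_model i) = coin"
  unfolding empirical_measure_def
proof (rule distr_balanced_eq_coin)
  let ?p = "large_prime i"
  have p0: "0 < ?p" using large_prime(2)[of i] by linarith
  show "finite (model_set True i)" by (simp add: model_set_def)
  have card_V: "card (model_set True i) = 2 * card (torus ?p)"
    unfolding model_set_def card_image[OF inj_on_subset[OF inj_to_nat subset_UNIV]]
    by (simp add: cover_def card_cartesian_product sheets_def)
  moreover have "0 < card (torus ?p)" using p0 by (simp add: card_torus)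
  ultimately show "model_set True i \<noteq> {}" by fastforce
  show "sheet_model i \<in> model_set True i \<rightarrow> two_points"
    using sheet_model_in_two_points by blast
  fix s :: real assume s: "s = 1 \<or> s = -1"
  then obtain t :: int where t: "s = of_int t" "t = 1 \<or> t = -1" by (metis of_int_1 of_int_minus)
  have "card {v \<in> model_set True i. sheet_model i v = const_seq s}
      = card {w \<in> cover ?p True. sheet_model i (to_nat w) = const_seq s}"
    unfolding model_set_def by (rule card_codes)
  also have "{w \<in> cover ?p True. sheet_model i (to_nat w) = const_seq s} = torus ?p \<times> {t}"
    using t by (auto simp: sheet_model_code cover_def sheets_def)
  finally show "2 * card {v \<in> model_set True i. sheet_model i v = const_seq s} = card (model_set True i)"
    by (simp add: card_V card_cartesian_product)
qed

theorem theorem4p1: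
  "\<exists>(G :: nat monoid)
     (V\<^sub>1 :: nat \<Rightarrow> nat set) \<sigma>\<^sub>1 (V\<^sub>2 :: nat \<Rightarrow> nat set) \<sigma>\<^sub>2
     (X :: (nat \<Rightarrow> real) topology) T.
     sofic_group G \<and>
     sofic_approximation G V\<^sub>1 \<sigma>\<^sub>1 \<and> sofic_approximation G V\<^sub>2 \<sigma>\<^sub>2 \<and>
     compact_space X \<and> metrizable_space X \<and> continuous_group_action G X T \<and>
     (\<forall>\<rho>. generating_pseudometric G X T \<rho> \<longrightarrow>
        top_sofic_entropy G X T \<rho> V\<^sub>1 \<sigma>\<^sub>1 \<noteq> top_sofic_entropy G X T \<rho> V\<^sub>2 \<sigma>\<^sub>2) \<and>
     (\<exists>\<mu>\<in>borel_prob_measures X. invariant_measure G X T \<mu> \<and>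
        (\<forall>\<rho>. generating_pseudometric G X T \<rho> \<longrightarrow>
           measure_sofic_entropy G X T \<rho> \<mu> V\<^sub>1 \<sigma>\<^sub>1 \<noteq> measure_sofic_entropy G X T \<rho> \<mu> V\<^sub>2 \<sigma>\<^sub>2))"
proof -
  let ?G = affine_group and ?X = "discrete_topology two_points" and ?T = sign_action
  have sofic: "sofic_group ?G"
    unfolding sofic_group_def
    by (intro conjI group_affine_group countableI_type exI[of _ "model_set False"]
      exI[of _ "model_act False"] sofic_approximation_model)
  have compact: "compact_space ?X" "metrizable_space ?X"
    by (simp_all add: compact_space_discrete_topology)
  have MInf: "top_sofic_entropy ?G ?X ?T \<rho> (model_set False) (model_act False) = - \<infinity>"
      "measure_sofic_entropy ?G ?X ?T \<rho> coin (model_set False) (model_act False) = - \<infinity>"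
    and nonneg: "0 \<le> top_sofic_entropy ?G ?X ?T \<rho> (model_set True) (model_act True)"
      "0 \<le> measure_sofic_entropy ?G ?X ?T \<rho> coin (model_set True) (model_act True)"
    if gen: "generating_pseudometric ?G ?X ?T \<rho>" for \<rho>
  proof -
    from gen obtain r where r0: "0 < r"
      and "\<forall>x\<in>two_points. \<forall>y\<in>two_points. \<rho> x y = (if x = y then 0 else r)"
      by (rule pseudometric_two_points)
    then have \<rho>: "\<rho> x y = (if x = y then 0 else r)" if "x \<in> two_points" "y \<in> two_points" for x y
      using that by blast
    note r = r0 \<rho>
    have empty: "\<forall>\<^sub>F i in sequentially. Map_set ?X ?T \<rho> (to_nat ` test_elements) (r / sqrt 4000)
        (model_set False i) (model_act False i) = {}"
      by (rule always_eventually, rule allI, rule no_models_on_torus[OF r])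
    have large: "filterlim (\<lambda>i. card (model_set False i)) at_top sequentially"
      using sofic_approximation_model[of False] by (simp add: sofic_approximation_def)
    have "finite (to_nat ` test_elements)" "0 < r / sqrt 4000"
      using r0 by (simp_all add: test_elements_def)
    note * = entropies_eq_MInf[OF this(1) test_elements_in_carrier this(2) empty large]
    show "top_sofic_entropy ?G ?X ?T \<rho> (model_set False) (model_act False) = - \<infinity>"
      "measure_sofic_entropy ?G ?X ?T \<rho> coin (model_set False) (model_act False) = - \<infinity>"
      by (rule *(1), rule *(2), rule coin_in_borel_prob)
    have fin: "finite (topspace ?X)" "\<And>i. finite (model_set True i)"
      by (simp_all add: model_set_def)
    show "0 \<le> top_sofic_entropy ?G ?X ?T \<rho> (model_set True) (model_act True)"
      by (rule entropies_nonneg(1)[OF fin]) (rule sheet_model_in_Map_set[OF r])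
    show "0 \<le> measure_sofic_entropy ?G ?X ?T \<rho> coin (model_set True) (model_act True)"
      by (rule entropies_nonneg(2)[OF fin]) (rule sheet_model_in_Map_set[OF r], assumption+, rule empirical_sheet_model)
  qed
  have no_neg: "\<not> (0::ereal) \<le> - \<infinity>" by simp
  have top: "\<forall>\<rho>. generating_pseudometric ?G ?X ?T \<rho> \<longrightarrow>
      top_sofic_entropy ?G ?X ?T \<rho> (model_set False) (model_act False)
        \<noteq> top_sofic_entropy ?G ?X ?T \<rho> (model_set True) (model_act True)"
  proof (intro allI impI)
    fix \<rho> assume "generating_pseudometric ?G ?X ?T \<rho>"
    from MInf(1)[OF this] nonneg(1)[OF this] show "top_sofic_entropy ?G ?X ?T \<rho> (model_set False) (model_act False)
        \<noteq> top_sofic_entropy ?G ?X ?T \<rho> (model_set True) (model_act True)"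
      using no_neg by metis
  qed
  have meas: "\<forall>\<rho>. generating_pseudometric ?G ?X ?T \<rho> \<longrightarrow>
      measure_sofic_entropy ?G ?X ?T \<rho> coin (model_set False) (model_act False)
        \<noteq> measure_sofic_entropy ?G ?X ?T \<rho> coin (model_set True) (model_act True)"
  proof (intro allI impI)
    fix \<rho> assume "generating_pseudometric ?G ?X ?T \<rho>"
    from MInf(2)[OF this] nonneg(2)[OF this] show "measure_sofic_entropy ?G ?X ?T \<rho> coin (model_set False) (model_act False)
        \<noteq> measure_sofic_entropy ?G ?X ?T \<rho> coin (model_set True) (model_act True)"
      using no_neg by metis
  qed
  show ?thesis
    by (rule exI[of _ ?G], rule exI[of _ "model_set False"], rule exI[of _ "model_act False"],
        rule exI[of _ "model_set True"], rule exI[of _ "model_act True"], rule exI[of _ ?X],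
        rule exI[of _ ?T])
       (intro conjI bexI[of _ coin] sofic sofic_approximation_model compact continuous_sign_action
          invariant_coin coin_in_borel_prob top meas)
qed

end
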